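(* Let $m\ge2$. Let $b_0,b_1,\dots$ be positive numbers with $\delta_k:=b_{k+1}/b_k$ bounded, let $H^2(\beta)$ be the Hilbert space of formal power series with norm $\|f\|^2=\sum_{k\ge0}b_k^2\|f_{[k]}\|^2_{L^2(\partial\mathbb B,\sigma)}$, and let $M_z$ be the multiplication $m$-tuple on it. Let $1\le p<\infty$. Then the following are equivalent: (1) $[M_{z_j}^*,M_{z_j}]\in\mathcal S^p$ for all $1\le j\le m$; (2) $[M_{z_j}^*,M_{z_l}]\in\mathcal S^p$ for all $1\le j,l\le m$; (3) $\displaystyle\sum_{k=1}^\infty\delta_k^{2p}k^{m-p-1}+\sum_{k=1}^\infty\big|\delta_k^2-\delta_{k-1}^2\big|^pk^{m-1}<\infty.$
   Context: $f_{[k]}$ is the homogeneous part of degree $k$ of a formal power series $f$ in $z_1,\dots,z_m$; $\sigma$ is the normalized surface measure on the unit sphere $\partial\mathbb B$ of $\mathbb C^m$. $\mathcal S^p$ is the Schatten $p$-class and $[A,B]=AB-BA$. *)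

theory Defs
  imports "HOL-Analysis.Analysis"
begin

text \<open>Formal power series in the variables z_i, i in the finite index type 'n
  (so m = CARD('n)), represented by their coefficient functions on multi-indices.\<close>
type_synonym 'n fps = "('n \<Rightarrow> nat) \<Rightarrow> complex"

text \<open>Normalized surface measure on the unit sphere of C^m: the push-forward of the
  normalized Lebesgue measure on the unit ball under radial projection x / |x|.\<close>
definition sphere_measure :: "(complex^'n::finite) measure" where
  "sphere_measure = distr (uniform_measure lborel (ball 0 1)) borel sgn"

definition mdeg :: "('n::finite \<Rightarrow> nat) \<Rightarrow> nat" where
  "mdeg \<alpha> = (\<Sum>i\<in>UNIV. \<alpha> i)"

definition monom_fun :: "('n::finite \<Rightarrow> nat) \<Rightarrow> complex^'n \<Rightarrow> complex" where
  "monom_fun \<alpha> z = (\<Prod>i\<in>UNIV. (z$i) ^ (\<alpha> i))"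

definition hom_part :: "'n::finite fps \<Rightarrow> nat \<Rightarrow> complex^'n \<Rightarrow> complex" where
  "hom_part f k z = (\<Sum>\<alpha>\<in>{\<alpha>. mdeg \<alpha> = k}. f \<alpha> * monom_fun \<alpha> z)"

definition L2S_normsq :: "(complex^'n::finite \<Rightarrow> complex) \<Rightarrow> real" where
  "L2S_normsq g = integral\<^sup>L sphere_measure (\<lambda>z. (cmod (g z))\<^sup>2)"

definition L2S_inner :: "(complex^'n::finite \<Rightarrow> complex) \<Rightarrow> (complex^'n \<Rightarrow> complex) \<Rightarrow> complex" where
  "L2S_inner g h = integral\<^sup>L sphere_measure (\<lambda>z. g z * cnj (h z))"

definition Hb_space :: "(nat \<Rightarrow> real) \<Rightarrow> 'n::finite fps set" where
  "Hb_space b = {f. summable (\<lambda>k. (b k)\<^sup>2 * L2S_normsq (hom_part f k))}"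

definition Hb_norm :: "(nat \<Rightarrow> real) \<Rightarrow> 'n::finite fps \<Rightarrow> real" where
  "Hb_norm b f = sqrt (\<Sum>k. (b k)\<^sup>2 * L2S_normsq (hom_part f k))"

definition Hb_inner :: "(nat \<Rightarrow> real) \<Rightarrow> 'n::finite fps \<Rightarrow> 'n fps \<Rightarrow> complex" where
  "Hb_inner b f g = (\<Sum>k. complex_of_real ((b k)\<^sup>2) * L2S_inner (hom_part f k) (hom_part g k))"

definition Mz :: "'n \<Rightarrow> 'n fps \<Rightarrow> 'n fps" where
  "Mz j f = (\<lambda>\<alpha>. if \<alpha> j = 0 then 0 else f (\<alpha>(j := \<alpha> j - 1)))"

definition Hb_adj :: "(nat \<Rightarrow> real) \<Rightarrow> ('n::finite fps \<Rightarrow> 'n fps) \<Rightarrow> ('n fps \<Rightarrow> 'n fps)" where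
  "Hb_adj b T = (\<lambda>g. THE h. h \<in> Hb_space b \<and>
      (\<forall>f\<in>Hb_space b. Hb_inner b (T f) g = Hb_inner b f h))"

definition comm :: "('n fps \<Rightarrow> 'n fps) \<Rightarrow> ('n fps \<Rightarrow> 'n fps) \<Rightarrow> ('n fps \<Rightarrow> 'n fps)" where
  "comm A B = (\<lambda>f \<alpha>. A (B f) \<alpha> - B (A f) \<alpha>)"

definition Hb_linear :: "(nat \<Rightarrow> real) \<Rightarrow> ('n::finite fps \<Rightarrow> 'n fps) \<Rightarrow> bool" where
  "Hb_linear b F \<longleftrightarrow> (\<forall>f\<in>Hb_space b. F f \<in> Hb_space b) \<and>
     (\<forall>f\<in>Hb_space b. \<forall>g\<in>Hb_space b. \<forall>c::complex.
        F (\<lambda>\<alpha>. c * f \<alpha> + g \<alpha>) = (\<lambda>\<alpha>. c * F f \<alpha> + F g \<alpha>))"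

definition Hb_bounded :: "(nat \<Rightarrow> real) \<Rightarrow> ('n::finite fps \<Rightarrow> 'n fps) \<Rightarrow> bool" where
  "Hb_bounded b T \<longleftrightarrow> (\<exists>C. \<forall>f\<in>Hb_space b. Hb_norm b (T f) \<le> C * Hb_norm b f)"

definition Hb_rank_le :: "(nat \<Rightarrow> real) \<Rightarrow> ('n::finite fps \<Rightarrow> 'n fps) \<Rightarrow> nat \<Rightarrow> bool" where
  "Hb_rank_le b F n \<longleftrightarrow> (\<exists>v. (\<forall>i<n. v i \<in> Hb_space b) \<and>
     (\<forall>f\<in>Hb_space b. \<exists>a::nat \<Rightarrow> complex. F f = (\<lambda>\<alpha>. \<Sum>i<n. a i * v i \<alpha>)))"

text \<open>n-th singular number (approximation number, n = 0,1,...):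
  s_n(T) = inf { ||T - F|| : F bounded linear, rank F \<le> n }.\<close>
definition sing_num :: "(nat \<Rightarrow> real) \<Rightarrow> ('n::finite fps \<Rightarrow> 'n fps) \<Rightarrow> nat \<Rightarrow> real" where
  "sing_num b T n = Inf {C. C \<ge> 0 \<and> (\<exists>F. Hb_linear b F \<and> Hb_bounded b F \<and> Hb_rank_le b F n \<and>
      (\<forall>f\<in>Hb_space b. Hb_norm b (\<lambda>\<alpha>. T f \<alpha> - F f \<alpha>) \<le> C * Hb_norm b f))}"

definition schatten :: "(nat \<Rightarrow> real) \<Rightarrow> real \<Rightarrow> ('n::finite fps \<Rightarrow> 'n fps) \<Rightarrow> bool" where
  "schatten b p T \<longleftrightarrow> Hb_linear b T \<and> Hb_bounded b T \<and> summable (\<lambda>n. sing_num b T n powr p)"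

definition delta :: "(nat \<Rightarrow> real) \<Rightarrow> nat \<Rightarrow> real" where
  "delta b k = b (Suc k) / b k"

end

theory Submission
  imports Defs "HOL-Probability.Distributions"
begin

text \<open>The monomials are orthogonal in \<open>H^2(\<beta>)\<close>, by rotating one coordinate of the sphere, and the
  ratios of their norms follow from homogeneity of Gaussian integrals. Hence all commutators are weighted
  partial permutations of an orthogonal basis, and their Schatten norms are sums over multi-indices.
  With \<open>d_k = \<delta>_k^2 / (k + m)\<close> and \<open>c_k = d_k - d_{k-1}\<close>, the commutator with \<open>j = l\<close> multiplies
  \<open>z^\<alpha>\<close>, \<open>|\<alpha>| = k\<close>, by the affine function \<open>c_k \<alpha>_j + d_k\<close>, and the weights for \<open>j \<noteq> l\<close> are
  at most \<open>|c_k| (k + 1)\<close>. Since there are about \<open>k^(m-1)\<close> multi-indices of degree \<open>k\<close>, and \<open>\<alpha>_j\<close>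
  spreads over \<open>{0..k}\<close>, the slope and the intercept are separately controlled by the diagonal commutators:
  all three conditions say that \<open>|c_k|^p k^(p+m-1)\<close> and \<open>d_k^p k^(m-1)\<close> are summable. Condition (3) is
  this in terms of \<open>\<delta>_k^2 - \<delta>_{k-1}^2 = c_k (k + m - 1) + d_k\<close>.\<close>

section \<open>Rotation invariance of Lebesgue measure\<close>

text \<open>The sphere measure is a push-forward of Lebesgue measure on the ball, so each fact about
  it is obtained by transforming Lebesgue integrals over C^m. The Gaussian weight decouples the
  coordinates: homogeneity in one coordinate and homogeneity in all of them become two numerical
  factors, whose quotient is the ratio of the norms of \<open>z^(\<alpha> + e_j)\<close> and
  \<open>z^\<alpha>\<close>. Schatten classes are defined by approximation numbers, so passing to
  sums over multi-indices takes two bounds. The upper one, by truncation to the largest weights, is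
  needed for all commutators. The lower one, by a dimension count against operators of rank at most
  n, is needed only for diagonal operators, because (1) is made to imply (3) directly. The obstacle
  in (1) ==> (3) is cancellation: \<open>c_k\<close> may be negative, so
  \<open>c_k \<alpha>_j + d_k\<close> may vanish for some \<alpha> although \<open>c_k\<close> and
  \<open>d_k\<close> do not. The slope is therefore read off from differences of weights at two
  multi-indices of equal degree, which exist because m is at least 2; the intercept then follows by
  the triangle inequality.\<close>

lemma nn_integral_lborel_shear:
  fixes F :: "'a::euclidean_space \<Rightarrow> ennreal"
  assumes [measurable]: "F \<in> borel_measurable borel"
    and ab: "a \<in> Basis" "b \<in> Basis" "a \<noteq> b"
  shows "(\<integral>\<^sup>+x. F (x + (c * (x \<bullet> a)) *\<^sub>R b) \<partial>lborel) = (\<integral>\<^sup>+x. F x \<partial>lborel)"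
proof -
  define I where "I = Basis - {b}"
  have I: "finite I" "b \<notin> I" "insert b I = Basis" "a \<in> I"
    using ab by (auto simp: I_def)
  define s :: "('a \<Rightarrow> real) \<Rightarrow> 'a" where "s f = (\<Sum>i\<in>Basis. f i *\<^sub>R i)" for f
  interpret product_sigma_finite "\<lambda>_::'a. lborel :: real measure"
    by standard
  have [measurable]: "s \<in> borel_measurable (Pi\<^sub>M Basis (\<lambda>_. lborel))"
    unfolding s_def by measurable
  have [measurable]: "s \<in> borel_measurable (Pi\<^sub>M (insert b I) (\<lambda>_. lborel))"
    using I by simp
  have s_inner: "s f \<bullet> i = f i" if "i \<in> Basis" for f i
    using that by (simp add: s_def inner_sum_left inner_Basis if_distrib cong: if_cong)
  \<comment> \<open>Lebesgue measure is a product over the basis. With all coordinates except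
    \<open>b\<close> frozen, the shear only translates coordinate \<open>b\<close> by the constant
    \<open>c * f a\<close>, so the inner integral does not change.\<close>
  have upd: "s (f(b := y)) + (c * (s (f(b := y)) \<bullet> a)) *\<^sub>R b = s (f(b := c * f a + y))" for f y
  proof (rule euclidean_eqI)
    fix i :: 'a assume i: "i \<in> Basis"
    show "(s (f(b := y)) + (c * (s (f(b := y)) \<bullet> a)) *\<^sub>R b) \<bullet> i = s (f(b := c * f a + y)) \<bullet> i"
      using ab i by (cases "i = b") (simp_all add: inner_add_left s_inner inner_Basis)
  qed
  have *: "(\<integral>\<^sup>+x. G x \<partial>lborel)
      = (\<integral>\<^sup>+f. (\<integral>\<^sup>+y. G (s (f(b := y))) \<partial>lborel) \<partial>Pi\<^sub>M I (\<lambda>_. lborel))"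
    if [measurable]: "G \<in> borel_measurable borel" for G
  proof -
    have "(\<integral>\<^sup>+x. G x \<partial>lborel) = (\<integral>\<^sup>+f. G (s f) \<partial>Pi\<^sub>M (insert b I) (\<lambda>_. lborel))"
      unfolding I by (subst lborel_eq) (simp add: nn_integral_distr s_def)
    also have "\<dots> = (\<integral>\<^sup>+f. (\<integral>\<^sup>+y. G (s (f(b := y))) \<partial>lborel) \<partial>Pi\<^sub>M I (\<lambda>_. lborel))"
      by (subst product_nn_integral_insert[OF I(1,2)]) auto
    finally show ?thesis .
  qed
  have [measurable]: "(\<lambda>y. s (f(b := y))) \<in> borel_measurable borel" for f
  proof -
    have "(\<lambda>y. s (f(b := y))) = (\<lambda>y. \<Sum>i\<in>Basis. (if i = b then y else f i) *\<^sub>R i)"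
      by (auto simp: s_def fun_eq_iff intro!: sum.cong)
    thus ?thesis by simp
  qed
  have "(\<integral>\<^sup>+y. F (s (f(b := y)) + (c * (s (f(b := y)) \<bullet> a)) *\<^sub>R b) \<partial>lborel)
      = (\<integral>\<^sup>+y. F (s (f(b := y))) \<partial>lborel)" for f
    unfolding upd
    using nn_integral_real_affine[of "\<lambda>y. F (s (f(b := y)))" 1 "c * f a"] by simp
  thus ?thesis
    by (subst (1 2) *) auto
qed

text \<open>A plane rotation is a product of three shears.\<close>

lemma nn_integral_lborel_rotation:
  fixes F :: "'a::euclidean_space \<Rightarrow> ennreal"
  assumes [measurable]: "F \<in> borel_measurable borel"
    and ab: "a \<in> Basis" "b \<in> Basis" "a \<noteq> b"
    and pq: "p\<^sup>2 + q\<^sup>2 = 1" "p \<noteq> -1"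
  shows "(\<integral>\<^sup>+x. F (x + ((p - 1) * (x \<bullet> a) - q * (x \<bullet> b)) *\<^sub>R a
             + (q * (x \<bullet> a) + (p - 1) * (x \<bullet> b)) *\<^sub>R b) \<partial>lborel) = (\<integral>\<^sup>+x. F x \<partial>lborel)"
proof -
  \<comment> \<open>For p = cos(theta), q = sin(theta) this is -tan(theta/2), which is defined
    exactly when p is not -1; \<open>tq\<close> and \<open>tp\<close> are the half-angle
    identities.\<close>
  define t where "t = - q / (1 + p)"
  have p1: "1 + p \<noteq> 0" using pq by auto
  have tq: "t * q = p - 1"
  proof -
    have "- q * q = (p - 1) * (1 + p)" using pq(1) by (simp add: algebra_simps power2_eq_square)
    moreover have "t * q = (- q * q) / (1 + p)" by (simp add: t_def)
    ultimately show ?thesis using p1 by simp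
  qed
  have tp: "t * (p + 1) = - q"
    using p1 unfolding t_def by (simp add: add.commute)
  define S where "S x = x + (t * (x \<bullet> b)) *\<^sub>R a" for x :: 'a
  define R where "R x = x + (q * (x \<bullet> a)) *\<^sub>R b" for x :: 'a
  have [measurable]: "S \<in> borel_measurable borel" "R \<in> borel_measurable borel"
    unfolding S_def R_def by measurable
  have in1: "a \<bullet> a = 1" "b \<bullet> b = 1" "a \<bullet> b = 0" "b \<bullet> a = 0"
    using ab by (auto simp: inner_Basis)
  have "S (R (S x)) = x + ((p - 1) * (x \<bullet> a) - q * (x \<bullet> b)) *\<^sub>R a
             + (q * (x \<bullet> a) + (p - 1) * (x \<bullet> b)) *\<^sub>R b" for x
  proof -
    define u v where "u = x \<bullet> a" and "v = x \<bullet> b"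
    have 1: "S x \<bullet> a = u + t * v" "S x \<bullet> b = v"
      by (simp_all add: S_def inner_add_left in1 u_def v_def)
    have 2: "R (S x) \<bullet> b = v + q * (u + t * v)"
      unfolding R_def by (simp add: inner_add_left in1 1)
    have "S (R (S x)) = x + (t * v) *\<^sub>R a + (q * (u + t * v)) *\<^sub>R b + (t * (v + q * (u + t * v))) *\<^sub>R a"
      unfolding S_def[of "R (S x)"] 2 unfolding R_def[of "S x"] 1 unfolding S_def v_def by simp
    also have "\<dots> = x + (t * v + t * (v + q * (u + t * v))) *\<^sub>R a + (q * (u + t * v)) *\<^sub>R b"
      by (simp only: scaleR_add_left add_ac)
    also have "t * v + t * (v + q * (u + t * v)) = (p - 1) * u - q * v"
    proof -
      have "t * v + t * (v + q * (u + t * v)) = (t * q) * u + (t * (2 + t * q)) * v"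
        by (simp add: algebra_simps)
      also have "\<dots> = (p - 1) * u + (t * (p + 1)) * v"
        unfolding tq by (simp add: algebra_simps)
      finally show ?thesis unfolding tp by simp
    qed
    also have "q * (u + t * v) = q * u + (t * q) * v" by (simp add: algebra_simps)
    finally show ?thesis unfolding tq u_def v_def .
  qed
  hence "(\<integral>\<^sup>+x. F (x + ((p - 1) * (x \<bullet> a) - q * (x \<bullet> b)) *\<^sub>R a
             + (q * (x \<bullet> a) + (p - 1) * (x \<bullet> b)) *\<^sub>R b) \<partial>lborel) = (\<integral>\<^sup>+x. F (S (R (S x))) \<partial>lborel)"
    by simp
  also have "\<dots> = (\<integral>\<^sup>+x. F (S (R x)) \<partial>lborel)"
    using nn_integral_lborel_shear[of "\<lambda>x. F (S (R x))" b a t] ab by (simp add: S_def[symmetric])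
  also have "\<dots> = (\<integral>\<^sup>+x. F (S x) \<partial>lborel)"
    using nn_integral_lborel_shear[of "\<lambda>x. F (S x)" a b q] ab by (simp add: R_def[symmetric])
  also have "\<dots> = (\<integral>\<^sup>+x. F x \<partial>lborel)"
    using nn_integral_lborel_shear[of F b a t] ab by (simp add: S_def[symmetric])
  finally show ?thesis .
qed

definition rotate_coord :: "'n \<Rightarrow> complex \<Rightarrow> complex^'n \<Rightarrow> complex^'n::finite" where
  "rotate_coord i w z = (\<chi> k. if k = i then w * z$k else z$k)"

lemma measurable_rotate_coord [measurable]: "rotate_coord i w \<in> borel_measurable borel"
proof -
  have "continuous_on UNIV (rotate_coord i w)"
    unfolding rotate_coord_def
    apply (intro continuous_on_vec_lambda)
    subgoal for k by (cases "k = i") (auto intro!: continuous_intros)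
    done
  thus ?thesis by (rule borel_measurable_continuous_onI)
qed

text \<open>On the real plane spanned by \<open>axis i 1\<close> and \<open>axis i \<i>\<close>,
  multiplication by \<open>w\<close> is the rotation with p = \<open>Re w\<close> and q =
  \<open>Im w\<close>. The half-turn \<open>w = -1\<close> is the case that the shear factorisation
  misses; orthogonality will use angles of at most pi/2.\<close>

lemma lborel_rotate_coord:
  fixes i :: "'n::finite"
  assumes w: "cmod w = 1" "w \<noteq> -1"
  shows "distr lborel borel (rotate_coord i w) = lborel"
proof (rule measure_eqI)
  fix A :: "(complex^'n) set" assume "A \<in> sets (distr lborel borel (rotate_coord i w))"
  hence [measurable]: "A \<in> sets borel" by simp
  define a b :: "complex^'n" where "a = axis i 1" and "b = axis i \<i>"
  have ab: "a \<in> Basis" "b \<in> Basis" "a \<noteq> b"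
    by (auto simp: a_def b_def axis_in_Basis_iff Basis_complex_def axis_eq_axis)
  have pq: "(Re w)\<^sup>2 + (Im w)\<^sup>2 = 1" using w by (simp add: cmod_def)
  have "Re w \<noteq> -1" using pq w(2) by (auto simp: complex_eq_iff)
  note rot = nn_integral_lborel_rotation[OF _ ab pq this, of "indicator A"]
  have in_ab: "x \<bullet> a = Re (x $ i)" "x \<bullet> b = Im (x $ i)" for x
    by (simp_all add: a_def b_def inner_axis inner_complex_def)
  have eq: "x + ((Re w - 1) * (x \<bullet> a) - Im w * (x \<bullet> b)) *\<^sub>R a
             + (Im w * (x \<bullet> a) + (Re w - 1) * (x \<bullet> b)) *\<^sub>R b = rotate_coord i w x" for x
    unfolding in_ab
    by (auto simp: vec_eq_iff rotate_coord_def a_def b_def axis_def complex_eq_iff algebra_simps)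
  have "emeasure (distr lborel borel (rotate_coord i w)) A = (\<integral>\<^sup>+x. indicator A (rotate_coord i w x) \<partial>lborel)"
    using nn_integral_distr[of "rotate_coord i w" lborel borel "indicator A"] by simp
  also have "\<dots> = emeasure lborel A" using rot unfolding eq by simp
  finally show "emeasure (distr lborel borel (rotate_coord i w)) A = emeasure lborel A" .
qed simp

section \<open>Gaussian integrals of homogeneous functions\<close>

text \<open>Two choices matter: \<open>J = {j}\<close> isolates a single complex variable, and
  \<open>J = UNIV\<close> is the ordinary dilation.\<close>

definition scale_coords :: "'n set \<Rightarrow> real \<Rightarrow> complex^'n \<Rightarrow> complex^'n::finite" where
  "scale_coords J r z = (\<chi> k. if k \<in> J then r *\<^sub>R z$k else z$k)"

lemma nn_integral_lborel_scale_coords: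
  fixes F :: "complex^'n::finite \<Rightarrow> ennreal"
  assumes [measurable]: "F \<in> borel_measurable borel" and r: "r > 0"
  shows "(\<integral>\<^sup>+x. F x \<partial>lborel) = ennreal (r ^ (2 * card J)) * (\<integral>\<^sup>+x. F (scale_coords J r x) \<partial>lborel)"
proof -
  \<comment> \<open>The factor of the real basis vector \<open>b = axis k u\<close>, which is
    supported on the coordinate \<open>k\<close> alone. Each complex coordinate carries two such
    vectors, hence the exponent \<open>2 * card J\<close>.\<close>
  define c where "c b = (if \<exists>k\<in>J. b $ k \<noteq> 0 then r else 1)" for b :: "complex^'n"
  have Basis_eq: "(Basis :: (complex^'n) set) = (\<lambda>(k, u). axis k u) ` (UNIV \<times> Basis)"
    by (auto simp: Basis_vec_def)
  have inj: "inj_on (\<lambda>(k, u). axis k u :: complex^'n) (UNIV \<times> Basis)"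
    by (auto simp: inj_on_def axis_eq_axis)
  have c_axis: "c (axis k u) = (if k \<in> J then r else 1)" if "u \<in> Basis" for k u
    using nonzero_Basis[OF that] by (auto simp: c_def axis_def)
  have T: "(\<Sum>j\<in>Basis. (c j * (x \<bullet> j)) *\<^sub>R j) = scale_coords J r x" for x
  proof (rule euclidean_eqI)
    fix b :: "complex^'n" assume b: "b \<in> Basis"
    then obtain k u where ku: "b = axis k u" "u \<in> Basis" by (auto simp: Basis_eq)
    have "(\<Sum>j\<in>Basis. (c j * (x \<bullet> j)) *\<^sub>R j) \<bullet> b = c b * (x \<bullet> b)"
      using b by (simp add: inner_sum_left inner_Basis if_distrib cong: if_cong)
    also have "\<dots> = scale_coords J r x \<bullet> b"
      using ku c_axis by (simp add: inner_axis scale_coords_def)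
    finally show "(\<Sum>j\<in>Basis. (c j * (x \<bullet> j)) *\<^sub>R j) \<bullet> b = scale_coords J r x \<bullet> b" .
  qed
  have [measurable]: "scale_coords J r \<in> borel_measurable borel"
    unfolding T[symmetric] by measurable
  have "(\<Prod>j\<in>Basis. \<bar>c j\<bar>) = (\<Prod>(k, u)\<in>UNIV \<times> (Basis :: complex set). if k \<in> J then r else 1)"
    unfolding Basis_eq using r
    by (subst prod.reindex[OF inj]) (auto intro!: prod.cong simp: c_axis)
  also have "\<dots> = (\<Prod>k\<in>UNIV. if k \<in> J then r ^ 2 else 1)"
    by (subst prod.cartesian_product[symmetric]) (auto intro!: prod.cong simp: power2_eq_square)
  also have "\<dots> = (\<Prod>k\<in>J. r ^ 2)"
    by (subst prod.If_cases) auto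
  finally have prod_c: "(\<Prod>j\<in>Basis. \<bar>c j\<bar>) = r ^ (2 * card J)"
    by (simp add: power_mult)
  have "lborel = density (distr lborel borel (\<lambda>x. 0 + (\<Sum>j\<in>Basis. (c j * (x \<bullet> j)) *\<^sub>R j)))
                         (\<lambda>_. ennreal (\<Prod>j\<in>Basis. \<bar>c j\<bar>))"
    by (rule lborel_affine_euclidean) (use r in \<open>auto simp: c_def\<close>)
  hence eq: "lborel = density (distr lborel borel (scale_coords J r)) (\<lambda>_. ennreal (r ^ (2 * card J)))"
    by (simp add: T prod_c)
  show ?thesis
    by (subst eq) (simp add: nn_integral_density nn_integral_distr nn_integral_cmult)
qed

lemma AE_lborel_coord_nonzero: "AE x in lborel. (x :: complex^'n::finite) $ j \<noteq> 0"
proof -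
  have "negligible {x :: complex^'n. axis j 1 \<bullet> x = 0}"
    by (rule negligible_hyperplane) (simp add: axis_eq_0_iff)
  moreover have [measurable]: "{x :: complex^'n. axis j 1 \<bullet> x = 0} \<in> sets borel"
    by (intro borel_closed closed_hyperplane)
  ultimately have "{x :: complex^'n. axis j 1 \<bullet> x = 0} \<in> null_sets lborel"
    by (simp add: negligible_iff_null_sets null_sets_def)
  thus ?thesis
    by (rule AE_I') (auto simp: inner_axis')
qed

text \<open>Source of the constant \<open>a + card J\<close> in the recursion below: there
  \<open>n\<close> is this number, and integrating the scaling law over \<open>s\<close> produces
  its reciprocal.\<close>

lemma nn_integral_powr_tail:
  assumes n: "n > 0"
  shows "(\<integral>\<^sup>+s. ennreal (1 / s ^ Suc n) * indicator {1..} s \<partial>lborel) = ennreal (1 / n)"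
proof -
  define F where "F s = - (1 / real n * inverse s ^ n)" for s :: real
  have "(\<integral>\<^sup>+s. ennreal (1 / s ^ Suc n) * indicator {1..} s \<partial>lborel) = ennreal (0 - F 1)"
  proof (rule nn_integral_FTC_atLeast[where F = F])
    show "(F has_real_derivative 1 / x ^ Suc n) (at x)" if "1 \<le> x" for x :: real
    proof -
      have "(F has_real_derivative - (1 / real n) * (real n * (- (inverse x ^ Suc (Suc 0)) * inverse x ^ (n - Suc 0)))) (at x)"
        unfolding F_def minus_mult_left using that
        by (intro DERIV_cmult DERIV_power DERIV_inverse) auto
      also have "- (1 / real n) * (real n * (- (inverse x ^ Suc (Suc 0)) * inverse x ^ (n - Suc 0))) = 1 / x ^ Suc n"
      proof -
        have "inverse x ^ Suc (Suc 0) * inverse x ^ (n - Suc 0) = inverse x ^ Suc n"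
          using n by (cases n) auto
        thus ?thesis using n by (simp add: inverse_eq_divide power_one_over)
      qed
      finally show ?thesis .
    qed
    show "(F \<longlongrightarrow> 0) at_top"
      unfolding F_def using n by real_asymp
  qed auto
  thus ?thesis by (simp add: F_def)
qed

text \<open>Used twice: with \<open>a = 1\<close> to integrate away the factor \<open>q x\<close> in
  the recursion, and with rate 1 and \<open>a = |x|^2\<close> to write a Gaussian as a superposition
  of indicators of balls.\<close>

lemma nn_integral_exp_tail:
  assumes q: "q > 0"
  shows "(\<integral>\<^sup>+s. ennreal (q * exp (- (s - a) * q)) * indicator {a..} s \<partial>lborel) = 1"
proof -
  define F where "F s = - exp (- (s - a) * q)" for s
  have "(\<integral>\<^sup>+s. ennreal (q * exp (- (s - a) * q)) * indicator {a..} s \<partial>lborel) = ennreal (0 - F a)"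
  proof (rule nn_integral_FTC_atLeast[where F = F])
    show "(F has_real_derivative q * exp (- (x - a) * q)) (at x)" for x
      unfolding F_def by (auto intro!: derivative_eq_intros)
    show "(F \<longlongrightarrow> 0) at_top"
      unfolding F_def using q by real_asymp
  qed (use q in auto)
  thus ?thesis by (simp add: F_def)
qed

text \<open>Let \<open>q x\<close> be the sum of \<open>|x_i|^2\<close> over \<open>i \<in> J\<close>. Rescaling the coordinates in \<open>J\<close> by
  \<open>1 / sqrt s\<close> shows that the integral of \<open>q h\<close> with weight \<open>exp (- |x|^2 - (s - 1) q x)\<close> is a power
  of \<open>s\<close> times its value at \<open>s = 1\<close>; integrating over \<open>s \<ge> 1\<close> then removes the factor \<open>q\<close>.\<close>

lemma gaussian_homogeneous_recursion:
  fixes h :: "complex^'n::finite \<Rightarrow> real"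
  assumes [measurable]: "h \<in> borel_measurable borel"
    and nn: "\<And>x. h x \<ge> 0"
    and J: "J \<noteq> {}"
    and hom: "\<And>r x. r > 0 \<Longrightarrow> h (scale_coords J r x) = r ^ (2 * a) * h x"
  shows "(\<integral>\<^sup>+x. ennreal ((\<Sum>i\<in>J. (cmod (x$i))\<^sup>2) * h x * exp (- (norm x)\<^sup>2)) \<partial>lborel)
       = ennreal (real (a + card J)) * (\<integral>\<^sup>+x. ennreal (h x * exp (- (norm x)\<^sup>2)) \<partial>lborel)"
proof -
  define q where "q x = (\<Sum>i\<in>J. (cmod (x$i))\<^sup>2)" for x :: "complex^'n"
  define n where "n = a + card J"
  have n: "n > 0" using J by (simp add: n_def card_gt_0_iff)
  have [measurable]: "(\<lambda>x::complex^'n. x $ i) \<in> borel_measurable borel" for i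
    by (intro borel_measurable_continuous_onI continuous_intros)
  have [measurable]: "q \<in> borel_measurable borel" unfolding q_def by measurable
  have q_nn: "q x \<ge> 0" for x by (auto simp: q_def intro: sum_nonneg)
  have norm_sq: "(norm x)\<^sup>2 = (\<Sum>i\<in>UNIV. (cmod (x$i))\<^sup>2)" for x :: "complex^'n"
    by (simp add: norm_vec_def L2_set_def sum_nonneg)
  have q_scale: "q (scale_coords J r x) = r\<^sup>2 * q x" for r x
    by (simp add: q_def scale_coords_def sum_distrib_left power_mult_distrib)
  have norm_scale: "(norm (scale_coords J r x))\<^sup>2 = (norm x)\<^sup>2 + (r\<^sup>2 - 1) * q x" for r x
  proof -
    have *: "(norm y)\<^sup>2 = q y + (\<Sum>i\<in>-J. (cmod (y$i))\<^sup>2)" for y :: "complex^'n"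
      unfolding norm_sq q_def by (subst sum.union_disjoint[symmetric]) auto
    have "(\<Sum>i\<in>-J. (cmod (scale_coords J r x$i))\<^sup>2) = (\<Sum>i\<in>-J. (cmod (x$i))\<^sup>2)"
      by (intro sum.cong) (auto simp: scale_coords_def)
    thus ?thesis unfolding *[of "scale_coords J r x"] *[of x] q_scale by (simp add: algebra_simps)
  qed
  define X where "X = (\<integral>\<^sup>+x. ennreal (q x * h x * exp (- (norm x)\<^sup>2)) \<partial>lborel)"
  define Y where "Y = (\<integral>\<^sup>+x. ennreal (h x * exp (- (norm x)\<^sup>2)) \<partial>lborel)"
  define F where "F s x = q x * h x * exp (- (norm x)\<^sup>2 - (s - 1) * q x)" for s x
  have F_nn: "F s x \<ge> 0" for s x by (simp add: F_def q_nn nn)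
  have [measurable]: "(\<lambda>(s, x). F s x) \<in> borel_measurable (borel \<Otimes>\<^sub>M borel)"
    unfolding F_def by measurable
  have int_x: "(\<integral>\<^sup>+x. ennreal (F s x) \<partial>lborel) = ennreal (1 / s ^ Suc n) * X" if s: "s \<ge> 1" for s
  proof -
    define r where "r = 1 / sqrt s"
    have r: "r > 0" "r\<^sup>2 = 1 / s" using s by (auto simp: r_def power_divide)
    have r_pow: "r ^ (2 * k) = 1 / s ^ k" for k
      by (simp add: power_mult r power_divide)
    have F_scale: "F s (scale_coords J r x) = 1 / s ^ Suc a * (q x * h x * exp (- (norm x)\<^sup>2))" for x
    proof -
      have "- (norm (scale_coords J r x))\<^sup>2 - (s - 1) * q (scale_coords J r x) = - (norm x)\<^sup>2"
        using s unfolding norm_scale q_scale r by (simp add: field_simps)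
      thus ?thesis unfolding F_def hom[OF r(1)] q_scale r_pow using s by (simp add: r field_simps)
    qed
    have "(\<integral>\<^sup>+x. ennreal (F s x) \<partial>lborel)
        = ennreal (r ^ (2 * card J)) * (\<integral>\<^sup>+x. ennreal (F s (scale_coords J r x)) \<partial>lborel)"
      by (rule nn_integral_lborel_scale_coords) (use r in measurable)
    also have "(\<integral>\<^sup>+x. ennreal (F s (scale_coords J r x)) \<partial>lborel) = ennreal (1 / s ^ Suc a) * X"
      unfolding F_scale X_def using s
      by (subst ennreal_mult') (auto simp: nn_integral_cmult)
    also have "ennreal (r ^ (2 * card J)) * (ennreal (1 / s ^ Suc a) * X) = ennreal (1 / s ^ Suc n) * X"
      unfolding mult.assoc[symmetric] r_pow n_def using s
      by (simp add: ennreal_mult'[symmetric] power_add field_simps)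
    finally show ?thesis .
  qed
  have int_s: "(\<integral>\<^sup>+s. ennreal (F s x) * indicator {1..} s \<partial>lborel) = ennreal (h x * exp (- (norm x)\<^sup>2))"
    if x: "q x > 0" for x
  proof -
    have "(\<integral>\<^sup>+s. ennreal (F s x) * indicator {1..} s \<partial>lborel) =
       (\<integral>\<^sup>+s. ennreal (h x * exp (- (norm x)\<^sup>2)) * (ennreal (q x * exp (- (s - 1) * q x)) * indicator {1..} s) \<partial>lborel)"
    proof (rule nn_integral_cong)
      fix s
      have "F s x = (h x * exp (- (norm x)\<^sup>2)) * (q x * exp (- (s - 1) * q x))"
        by (simp add: F_def exp_diff exp_minus field_simps exp_add[symmetric])
      thus "ennreal (F s x) * indicator {1..} s =
        ennreal (h x * exp (- (norm x)\<^sup>2)) * (ennreal (q x * exp (- (s - 1) * q x)) * indicator {1..} s)"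
        using nn x by (simp add: ennreal_mult'[symmetric] mult.assoc[symmetric])
    qed
    also have "\<dots> = ennreal (h x * exp (- (norm x)\<^sup>2))"
      using nn_integral_exp_tail[OF x, of 1] by (subst nn_integral_cmult) auto
    finally show ?thesis .
  qed
  obtain j where j: "j \<in> J" using J by auto
  have "AE x in lborel. q x > 0"
    using AE_lborel_coord_nonzero[of j]
  proof eventually_elim
    case (elim x)
    have "(cmod (x$j))\<^sup>2 \<le> q x" unfolding q_def using j by (intro member_le_sum) auto
    thus ?case using elim by (smt (verit) zero_less_power zero_less_norm_iff)
  qed
  hence "Y = (\<integral>\<^sup>+x. (\<integral>\<^sup>+s. ennreal (F s x) * indicator {1..} s \<partial>lborel) \<partial>lborel)"
    unfolding Y_def by (intro nn_integral_cong_AE) (auto simp: int_s elim: eventually_mono)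
  \<comment> \<open>Tonelli for nonnegative integrands: all quantities stay in
    \<open>ennreal\<close>, so finiteness of \<open>X\<close> and \<open>Y\<close> need not be
    known.\<close>
  also have "\<dots> = (\<integral>\<^sup>+s. (\<integral>\<^sup>+x. ennreal (F s x) * indicator {1..} s \<partial>lborel) \<partial>lborel)"
    by (rule lborel_pair.Fubini') measurable
  also have "\<dots> = (\<integral>\<^sup>+s. (ennreal (1 / s ^ Suc n) * indicator {1..} s) * X \<partial>lborel)"
    by (intro nn_integral_cong) (auto simp: int_x nn_integral_multc indicator_def)
  also have "\<dots> = ennreal (1 / n) * X"
    using nn_integral_powr_tail[OF n] by (subst nn_integral_multc) auto
  finally have "ennreal n * Y = (ennreal n * ennreal (1 / n)) * X" by (simp add: mult.assoc)
  also have "ennreal n * ennreal (1 / n) = 1"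
    using n by (simp flip: ennreal_mult')
  finally show ?thesis by (simp add: X_def Y_def q_def n_def)
qed

text \<open>Replaces polar coordinates. Write \<open>exp (- |x|^2)\<close> as the integral of
  \<open>exp (- s)\<close> over s > |x|^2. After exchanging integrals, a function of
  \<open>sgn x\<close> is integrated over the ball of radius sqrt s, which by dilation gives s^m
  times the unit ball value; the integral of s^m exp(-s) is m!.\<close>

lemma gaussian_radial:
  fixes f :: "complex^'n::finite \<Rightarrow> real"
  assumes [measurable]: "f \<in> borel_measurable borel" and nn: "\<And>x. f x \<ge> 0"
  shows "(\<integral>\<^sup>+x. ennreal (f (sgn x) * exp (- (norm x)\<^sup>2)) \<partial>lborel)
       = ennreal (fact CARD('n)) * (\<integral>\<^sup>+x. ennreal (f (sgn x)) * indicator (ball 0 1) x \<partial>lborel)"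
proof -
  define B where "B = (\<integral>\<^sup>+x. ennreal (f (sgn x)) * indicator (ball 0 1) x \<partial>lborel)"
  define I where "I s x = (if (norm x)\<^sup>2 < s then 1 else 0 :: ennreal)" for s and x :: "complex^'n"
  have [measurable]: "(\<lambda>(s, x). I s x) \<in> borel_measurable (borel \<Otimes>\<^sub>M borel)"
    unfolding I_def by measurable
  have 1: "ennreal (exp (- (norm x)\<^sup>2)) = (\<integral>\<^sup>+s. ennreal (exp (- s)) * I s x \<partial>lborel)" for x :: "complex^'n"
  proof -
    define a where "a = (norm x)\<^sup>2"
    have "(\<integral>\<^sup>+s. ennreal (exp (- s)) * I s x \<partial>lborel)
        = (\<integral>\<^sup>+s. ennreal (exp (- a)) * (ennreal (1 * exp (- (s - a) * 1)) * indicator {a..} s) \<partial>lborel)"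
      using AE_lborel_singleton[of a]
      by (intro nn_integral_cong_AE, elim eventually_mono)
         (auto simp: I_def a_def indicator_def ennreal_mult'[symmetric] exp_add[symmetric])
    also have "\<dots> = ennreal (exp (- a)) * (\<integral>\<^sup>+s. ennreal (1 * exp (- (s - a) * 1)) * indicator {a..} s \<partial>lborel)"
      by (rule nn_integral_cmult) measurable
    also have "\<dots> = ennreal (exp (- a))"
      by (subst nn_integral_exp_tail) auto
    finally show ?thesis by (simp add: a_def)
  qed
  have 2: "(\<integral>\<^sup>+x. ennreal (f (sgn x)) * I s x \<partial>lborel) = ennreal (s ^ CARD('n)) * B" if s: "s > 0" for s
  proof -
    have scale: "scale_coords UNIV (sqrt s) x = sqrt s *\<^sub>R x" for x :: "complex^'n"
      by (simp add: scale_coords_def vec_eq_iff)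
    have "(\<integral>\<^sup>+x. ennreal (f (sgn x)) * I s x \<partial>lborel) = ennreal (sqrt s ^ (2 * card (UNIV :: 'n set))) *
       (\<integral>\<^sup>+x. ennreal (f (sgn (scale_coords UNIV (sqrt s) x))) * I s (scale_coords UNIV (sqrt s) x) \<partial>lborel)"
      by (rule nn_integral_lborel_scale_coords) (use s in \<open>auto intro!: borel_measurable_times_ennreal\<close>)
    also have "sqrt s ^ (2 * card (UNIV :: 'n set)) = s ^ CARD('n)"
      using s by (simp add: power_mult)
    also have "(\<integral>\<^sup>+x. ennreal (f (sgn (scale_coords UNIV (sqrt s) x))) * I s (scale_coords UNIV (sqrt s) x) \<partial>lborel) = B"
      unfolding B_def using s
      by (intro nn_integral_cong)
         (auto simp: scale sgn_scaleR I_def power_mult_distrib indicator_def abs_square_less_1 power2_less_1_iff)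
    finally show ?thesis .
  qed
  have "(\<integral>\<^sup>+x. ennreal (f (sgn x) * exp (- (norm x)\<^sup>2)) \<partial>lborel)
      = (\<integral>\<^sup>+x. (\<integral>\<^sup>+s. ennreal (f (sgn x)) * (ennreal (exp (- s)) * I s x) \<partial>lborel) \<partial>lborel)"
    by (intro nn_integral_cong) (auto simp: ennreal_mult' nn 1 nn_integral_cmult)
  also have "\<dots> = (\<integral>\<^sup>+s. (\<integral>\<^sup>+x. ennreal (f (sgn x)) * (ennreal (exp (- s)) * I s x) \<partial>lborel) \<partial>lborel)"
    by (rule lborel_pair.Fubini') measurable
  also have "\<dots> = (\<integral>\<^sup>+s. (ennreal (s ^ CARD('n) * exp (- s)) * indicator {0..} s) * B \<partial>lborel)"
  proof (rule nn_integral_cong)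
    fix s :: real
    have "(\<integral>\<^sup>+x. ennreal (f (sgn x)) * (ennreal (exp (- s)) * I s x) \<partial>lborel)
        = (\<integral>\<^sup>+x. ennreal (exp (- s)) * (ennreal (f (sgn x)) * I s x) \<partial>lborel)"
      by (simp add: mult_ac)
    also have "\<dots> = ennreal (exp (- s)) * (\<integral>\<^sup>+x. (ennreal (f (sgn x)) * I s x) \<partial>lborel)"
      by (rule nn_integral_cmult) measurable
    also have "\<dots> = (ennreal (s ^ CARD('n) * exp (- s)) * indicator {0..} s) * B"
    proof (cases "s > 0")
      case True
      thus ?thesis unfolding 2[OF True] by (simp add: ennreal_mult mult_ac)
    next
      case False
      hence I0: "I s x = 0" for x by (simp add: I_def) (smt (verit) zero_le_power2)
      \<comment> \<open>At \<open>s = 0\<close> the indicator on the right is 1, but the power of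
        \<open>s\<close> has a positive exponent and vanishes.\<close>
      have "s = 0 \<or> s < 0" using False by auto
      thus ?thesis by (auto simp: I0)
    qed
    finally show "(\<integral>\<^sup>+x. ennreal (f (sgn x)) * (ennreal (exp (- s)) * I s x) \<partial>lborel)
        = (ennreal (s ^ CARD('n) * exp (- s)) * indicator {0..} s) * B" .
  qed
  also have "\<dots> = ennreal (fact CARD('n)) * B"
    using nn_intergal_power_times_exp_Ici[of "CARD('n)"] by (subst nn_integral_multc) auto
  finally show ?thesis by (simp add: B_def)
qed

section \<open>Monomials on the sphere\<close>

abbreviation inc :: "('n \<Rightarrow> nat) \<Rightarrow> 'n \<Rightarrow> 'n \<Rightarrow> nat" where
  "inc \<alpha> j \<equiv> \<alpha>(j := Suc (\<alpha> j))"

lemma mdeg_inc [simp]: "mdeg (inc \<alpha> j) = Suc (mdeg \<alpha>)"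
proof -
  have "mdeg \<beta> = \<beta> j + (\<Sum>i\<in>UNIV - {j}. \<beta> i)" for \<beta> :: "'a \<Rightarrow> nat"
    unfolding mdeg_def by (rule sum.remove) auto
  from this[of "inc \<alpha> j"] this[of \<alpha>] show ?thesis by simp
qed

lemma measurable_monom_fun [measurable]: "monom_fun \<alpha> \<in> borel_measurable borel"
  unfolding monom_fun_def by (intro borel_measurable_continuous_onI continuous_intros)

lemma measurable_cnj_monom_fun [measurable]: "(\<lambda>z. cnj (monom_fun \<alpha> z)) \<in> borel_measurable borel"
  unfolding monom_fun_def by (intro borel_measurable_continuous_onI continuous_intros)

lemma monom_fun_0 [simp]: "monom_fun (\<lambda>_. 0) z = 1"
  by (simp add: monom_fun_def)

lemma monom_fun_inc: "monom_fun (inc \<alpha> j) z = z $ j * monom_fun \<alpha> z"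
proof -
  have *: "monom_fun \<beta> z = (z $ j) ^ \<beta> j * (\<Prod>i\<in>UNIV - {j}. (z$i) ^ \<beta> i)" for \<beta>
    unfolding monom_fun_def by (rule prod.remove) auto
  have "(\<Prod>i\<in>UNIV - {j}. (z$i) ^ (inc \<alpha> j) i) = (\<Prod>i\<in>UNIV - {j}. (z$i) ^ \<alpha> i)"
    by (intro prod.cong) auto
  thus ?thesis by (simp add: *[of \<alpha>] *[of "inc \<alpha> j"])
qed

lemma monom_fun_scaleR: "monom_fun \<alpha> (r *\<^sub>R z) = of_real (r ^ mdeg \<alpha>) * monom_fun \<alpha> z"
  by (simp add: monom_fun_def mdeg_def scaleR_conv_of_real[where 'a = complex] power_mult_distrib
        prod.distrib power_sum)

lemma cmod_monom_fun_le:
  assumes "norm z \<le> 1"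
  shows "cmod (monom_fun \<alpha> z) \<le> 1"
proof -
  have "cmod (z $ i) \<le> 1" for i
    using Finite_Cartesian_Product.norm_nth_le[of z i] assms by linarith
  thus ?thesis
    unfolding monom_fun_def by (simp add: prod_norm[symmetric] norm_power prod_le_1 power_le_one)
qed

section \<open>The surface measure and the moments of monomials\<close>

text \<open>Never evaluated: as a positive finite constant it cancels from the moment
  ratios.\<close>

definition ball_vol :: "'n::finite itself \<Rightarrow> real" where
  "ball_vol _ = measure lborel (ball (0 :: complex^'n) 1)"

lemma ball_vol_pos: "ball_vol TYPE('n::finite) > 0"
  unfolding ball_vol_def using content_ball_pos[of 1 "0 :: complex^'n"] by simp

lemma emeasure_unit_ball: "emeasure lborel (ball (0 :: complex^'n::finite) 1) = ennreal (ball_vol TYPE('n))"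
  unfolding ball_vol_def using emeasure_lborel_ball_finite[of "0 :: complex^'n" 1]
  by (intro emeasure_eq_ennreal_measure) auto

lemma space_sphere_measure [simp]: "space sphere_measure = UNIV"
  and sets_sphere_measure [simp, measurable_cong]: "sets sphere_measure = sets borel"
  by (simp_all add: sphere_measure_def)

lemma prob_space_sphere_measure: "prob_space (sphere_measure :: (complex^'n::finite) measure)"
proof -
  interpret prob_space "uniform_measure lborel (ball (0 :: complex^'n) 1)"
    using ball_vol_pos[where 'n = 'n]
    by (intro prob_space_uniform_measure) (auto simp: emeasure_unit_ball)
  show ?thesis unfolding sphere_measure_def by (rule prob_space_distr) simp
qed

text \<open>Only the centre of the ball fails, since \<open>sgn 0 = 0\<close>, and a point is a null
  set.\<close>

lemma AE_sphere_measure: "AE z in (sphere_measure :: (complex^'n::finite) measure). norm z = 1"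
proof -
  have "AE x in uniform_measure lborel (ball (0 :: complex^'n) 1). norm (sgn x) = 1"
    by (rule AE_uniform_measureI)
       (auto intro!: eventually_mono[OF AE_lborel_singleton[of 0]] simp: norm_sgn)
  thus ?thesis unfolding sphere_measure_def by (subst AE_distr_iff) auto
qed

lemma nn_integral_sphere_measure:
  fixes f :: "complex^'n::finite \<Rightarrow> real"
  assumes [measurable]: "f \<in> borel_measurable borel" and nn: "\<And>x. f x \<ge> 0"
  shows "(\<integral>\<^sup>+x. ennreal (f (sgn x)) * indicator (ball 0 1) x \<partial>lborel)
       = ennreal (ball_vol TYPE('n)) * (\<integral>\<^sup>+z. ennreal (f z) \<partial>sphere_measure)"
proof -
  define v where "v = ball_vol TYPE('n)"
  have v: "v > 0" unfolding v_def by (rule ball_vol_pos)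
  have "(\<integral>\<^sup>+z. ennreal (f z) \<partial>sphere_measure)
      = (\<integral>\<^sup>+x. ennreal (f (sgn x)) * indicator (ball 0 1) x \<partial>lborel) / ennreal v"
    unfolding sphere_measure_def
    by (simp add: nn_integral_distr nn_integral_uniform_measure emeasure_unit_ball v_def)
  thus ?thesis using v unfolding v_def[symmetric]
    by (simp add: ennreal_times_divide mult.commute[of "ennreal v"] ennreal_mult_divide_eq)
qed

lemma integrable_monom_fun_mult:
  "integrable sphere_measure (\<lambda>z. monom_fun \<alpha> z * cnj (monom_fun \<beta> z))"
proof -
  interpret prob_space "sphere_measure :: (complex^'b) measure" by (rule prob_space_sphere_measure)
  show ?thesis
  proof (rule integrable_const_bound[where B = 1])
    show "AE z in sphere_measure. cmod (monom_fun \<alpha> z * cnj (monom_fun \<beta> z)) \<le> 1"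
      using AE_sphere_measure
      by eventually_elim (auto simp: norm_mult intro!: mult_le_one cmod_monom_fun_le)
  qed (simp add: borel_measurable_times measurable_monom_fun measurable_cnj_monom_fun)
qed

text \<open>The classical value is \<alpha>! (m-1)! / (m-1+|\<alpha>|)!. It is not computed here;
  the ratios in \<open>mom_inc\<close> and the value 1 at the zero multi-index determine it.\<close>

definition mom :: "('n::finite \<Rightarrow> nat) \<Rightarrow> real" where
  "mom \<alpha> = L2S_normsq (monom_fun \<alpha>)"

lemma integrable_cmod_monom_fun_sq: "integrable sphere_measure (\<lambda>z. (cmod (monom_fun \<alpha> z))\<^sup>2)"
  using integrable_norm[OF integrable_monom_fun_mult[of \<alpha> \<alpha>]]
  by (simp add: norm_mult power2_eq_square)

lemma ennreal_mom: "ennreal (mom \<alpha>) = (\<integral>\<^sup>+z. ennreal ((cmod (monom_fun \<alpha> z))\<^sup>2) \<partial>sphere_measure)"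
  unfolding mom_def L2S_normsq_def
  by (rule nn_integral_eq_integral[symmetric]) (auto intro: integrable_cmod_monom_fun_sq)

lemma mom_nonneg: "mom \<alpha> \<ge> 0"
  by (simp add: mom_def L2S_normsq_def)

lemma mom_0: "mom (\<lambda>_::'n::finite. 0) = 1"
proof -
  interpret prob_space "sphere_measure :: (complex^'n) measure" by (rule prob_space_sphere_measure)
  show ?thesis using prob_space by (simp add: mom_def L2S_normsq_def)
qed

text \<open>The squared modulus of the monomial equals its value at \<open>sgn x\<close> times
  |x|^(2|\<alpha>|). The recursion with \<open>J = UNIV\<close> removes one factor |x|^2 at a time
  at the cost of \<open>l + m\<close>, which builds the Pochhammer symbol; what remains is a
  function of \<open>sgn x\<close>, covered by \<open>gaussian_radial\<close>.\<close>

lemma gaussian_monom: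
  fixes \<alpha> :: "'n::finite \<Rightarrow> nat"
  shows "(\<integral>\<^sup>+x. ennreal ((cmod (monom_fun \<alpha> x))\<^sup>2 * exp (- (norm x)\<^sup>2)) \<partial>lborel)
       = ennreal (pochhammer (real CARD('n)) (mdeg \<alpha>) * fact CARD('n) * ball_vol TYPE('n) * mom \<alpha>)"
proof -
  define f where "f x = (cmod (monom_fun \<alpha> x))\<^sup>2" for x :: "complex^'n"
  have [measurable]: "f \<in> borel_measurable borel" unfolding f_def by measurable
  have f_nn: "f x \<ge> 0" for x by (simp add: f_def)
  define K where "K l = (\<integral>\<^sup>+x. ennreal (f (sgn x) * norm x ^ (2 * l) * exp (- (norm x)\<^sup>2)) \<partial>lborel)" for l
  have norm_sq: "(norm x)\<^sup>2 = (\<Sum>i\<in>UNIV. (cmod (x$i))\<^sup>2)" for x :: "complex^'n"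
    by (simp add: norm_vec_def L2_set_def sum_nonneg)
  have K_Suc: "K (Suc l) = ennreal (real (l + CARD('n))) * K l" for l
  proof -
    have scale: "scale_coords UNIV r x = r *\<^sub>R x" for r and x :: "complex^'n"
      by (simp add: scale_coords_def vec_eq_iff)
    have "K (Suc l) = (\<integral>\<^sup>+x. ennreal ((\<Sum>i\<in>UNIV. (cmod (x$i))\<^sup>2) * (f (sgn x) * norm x ^ (2 * l)) * exp (- (norm x)\<^sup>2)) \<partial>lborel)"
      unfolding K_def norm_sq[symmetric]
      by (intro nn_integral_cong) (simp add: power2_eq_square mult_ac)
    also have "\<dots> = ennreal (real (l + CARD('n))) * K l"
      unfolding K_def
    proof (rule gaussian_homogeneous_recursion)
      show "(\<lambda>x. f (sgn x) * norm x ^ (2 * l)) \<in> borel_measurable borel" by measurable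
      show "0 \<le> f (sgn x) * norm x ^ (2 * l)" for x by (simp add: f_nn)
      show "f (sgn (scale_coords UNIV r x)) * norm (scale_coords UNIV r x) ^ (2 * l)
          = r ^ (2 * l) * (f (sgn x) * norm x ^ (2 * l))" if "r > 0" for r x
        using that unfolding scale sgn_scaleR by (simp add: power_mult_distrib)
    qed simp
    finally show ?thesis .
  qed
  have K_0: "K 0 = ennreal (fact CARD('n) * ball_vol TYPE('n) * mom \<alpha>)"
  proof -
    have "K 0 = ennreal (fact CARD('n)) * (ennreal (ball_vol TYPE('n)) * (\<integral>\<^sup>+z. ennreal (f z) \<partial>sphere_measure))"
      unfolding K_def by (simp add: gaussian_radial f_nn nn_integral_sphere_measure)
    also have "(\<integral>\<^sup>+z. ennreal (f z) \<partial>sphere_measure) = ennreal (mom \<alpha>)"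
      by (simp add: ennreal_mom f_def)
    finally show ?thesis
      using ball_vol_pos[where 'n = 'n] by (simp add: ennreal_mult' mult.assoc)
  qed
  have K: "K l = ennreal (pochhammer (real CARD('n)) l * fact CARD('n) * ball_vol TYPE('n) * mom \<alpha>)" for l
  proof (induction l)
    case (Suc l)
    show ?case unfolding K_Suc Suc
      by (subst ennreal_mult'[symmetric]) (simp_all add: pochhammer_Suc mult_ac add_ac)
  qed (simp add: K_0)
  have f_eq: "f x = f (sgn x) * norm x ^ (2 * mdeg \<alpha>)" for x
  proof -
    have "f x = f (norm x *\<^sub>R sgn x)"
      by (cases "x = 0") (auto simp: sgn_div_norm)
    thus ?thesis
      by (simp add: f_def monom_fun_scaleR norm_mult power_mult_distrib norm_power mult.commute flip: power_mult)
  qed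
  have "(\<integral>\<^sup>+x. ennreal (f x * exp (- (norm x)\<^sup>2)) \<partial>lborel) = K (mdeg \<alpha>)"
    unfolding K_def by (intro nn_integral_cong arg_cong[where f = ennreal] arg_cong2[where f = "(*)"] refl f_eq)
  thus ?thesis unfolding K by (simp add: f_def)
qed

text \<open>The Gaussian integral of |z^(\<alpha>+e_j)|^2 is evaluated in two ways:
  \<open>gaussian_monom\<close> gives one more Pochhammer factor |\<alpha>| + m, while the recursion
  with \<open>J = {j}\<close> splits off |z_j|^2 with the factor \<alpha>_j + 1.\<close>

lemma mom_inc: "real (mdeg \<alpha> + CARD('n)) * mom (inc \<alpha> j) = real (Suc (\<alpha> j)) * mom (\<alpha> :: 'n::finite \<Rightarrow> nat)"
proof -
  define C where "C = pochhammer (real CARD('n)) (mdeg \<alpha>) * fact CARD('n) * ball_vol TYPE('n)"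
  have C: "C > 0" unfolding C_def using ball_vol_pos[where 'n = 'n]
    by (intro mult_pos_pos pochhammer_pos) auto
  have "(\<integral>\<^sup>+x. ennreal ((cmod (monom_fun (inc \<alpha> j) x))\<^sup>2 * exp (- (norm x)\<^sup>2)) \<partial>lborel)
      = (\<integral>\<^sup>+x. ennreal ((\<Sum>i\<in>{j}. (cmod (x$i))\<^sup>2) * (cmod (monom_fun \<alpha> x))\<^sup>2 * exp (- (norm x)\<^sup>2)) \<partial>lborel)"
    by (simp add: monom_fun_inc norm_mult power_mult_distrib)
  also have "\<dots> = ennreal (real (\<alpha> j + card {j})) *
      (\<integral>\<^sup>+x. ennreal ((cmod (monom_fun \<alpha> x))\<^sup>2 * exp (- (norm x)\<^sup>2)) \<partial>lborel)"
  proof (rule gaussian_homogeneous_recursion)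
    fix r :: real and x :: "complex^'n" assume r: "r > 0"
    have *: "monom_fun \<alpha> z = (z $ j) ^ \<alpha> j * (\<Prod>i\<in>UNIV - {j}. (z$i) ^ \<alpha> i)" for z :: "complex^'n"
      unfolding monom_fun_def by (rule prod.remove) auto
    have "(\<Prod>i\<in>UNIV - {j}. (scale_coords {j} r x$i) ^ \<alpha> i) = (\<Prod>i\<in>UNIV - {j}. (x$i) ^ \<alpha> i)"
      by (intro prod.cong) (auto simp: scale_coords_def)
    moreover have "cmod (scale_coords {j} r x $ j) = r * cmod (x $ j)"
      using r by (simp add: scale_coords_def)
    ultimately show "(cmod (monom_fun \<alpha> (scale_coords {j} r x)))\<^sup>2 = r ^ (2 * \<alpha> j) * (cmod (monom_fun \<alpha> x))\<^sup>2"
      by (simp add: * norm_mult norm_power power_mult_distrib mult.commute flip: power_mult)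
  qed auto
  also have "\<dots> = ennreal (real (Suc (\<alpha> j)) * (C * mom \<alpha>))"
    unfolding gaussian_monom C_def by (subst ennreal_mult') auto
  finally have "ennreal (C * (real (mdeg \<alpha> + CARD('n)) * mom (inc \<alpha> j))) = ennreal (C * (real (Suc (\<alpha> j)) * mom \<alpha>))"
    unfolding gaussian_monom by (simp add: C_def pochhammer_Suc mult_ac add_ac)
  moreover have "0 \<le> C * (real (mdeg \<alpha> + CARD('n)) * mom (inc \<alpha> j))" "0 \<le> C * (real (Suc (\<alpha> j)) * mom \<alpha>)"
    using C mom_nonneg[of \<alpha>] mom_nonneg[of "inc \<alpha> j"] by (auto intro!: mult_nonneg_nonneg)
  ultimately have "C * (real (mdeg \<alpha> + CARD('n)) * mom (inc \<alpha> j)) = C * (real (Suc (\<alpha> j)) * mom \<alpha>)"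
    by (simp only: ennreal_inj)
  thus ?thesis using C by simp
qed

lemma mom_pos: "mom (\<alpha> :: 'n::finite \<Rightarrow> nat) > 0"
proof (induction "mdeg \<alpha>" arbitrary: \<alpha>)
  case 0
  hence "\<alpha> = (\<lambda>_. 0)" by (auto simp: mdeg_def)
  thus ?case by (simp add: mom_0)
next
  case (Suc k)
  have "\<exists>j. \<alpha> j > 0"
  proof (rule ccontr)
    assume "\<nexists>j. \<alpha> j > 0"
    hence "mdeg \<alpha> = 0" by (simp add: mdeg_def)
    thus False using Suc by simp
  qed
  then obtain j where j: "\<alpha> j > 0" by auto
  define \<beta> where "\<beta> = \<alpha>(j := \<alpha> j - 1)"
  have \<alpha>: "\<alpha> = inc \<beta> j" using j by (auto simp: \<beta>_def)
  have "mom \<beta> > 0" using Suc \<alpha> by simp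
  moreover have "real (mdeg \<beta> + CARD('n)) > 0" by (simp add: add_nonneg_pos)
  ultimately have "mom (inc \<beta> j) > 0"
    using mom_inc[of \<beta> j] by (metis mult_pos_pos of_nat_0_less_iff zero_less_Suc zero_less_mult_pos)
  thus ?case using \<alpha> by simp
qed

section \<open>Rotation invariance of the sphere and orthogonality of monomials\<close>

text \<open>A coordinate rotation is an isometry, so it preserves the ball and commutes with
  \<open>sgn\<close>; invariance of Lebesgue measure then passes to the push-forward.\<close>

lemma distr_sphere_measure_rotate_coord:
  assumes w: "cmod w = 1" "w \<noteq> -1"
  shows "distr sphere_measure borel (rotate_coord i w) = (sphere_measure :: (complex^'n::finite) measure)"
proof -
  define g where "g x = indicator (ball 0 1) x / ennreal (ball_vol TYPE('n))" for x :: "complex^'n"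
  have norm_rot: "norm (rotate_coord i w x) = norm x" for x
    unfolding norm_vec_def L2_set_def
    by (intro arg_cong[where f = sqrt] sum.cong) (auto simp: rotate_coord_def norm_mult w)
  have unif: "uniform_measure lborel (ball 0 1) = density lborel g"
    unfolding uniform_measure_def g_def by (simp add: emeasure_unit_ball)
  have g_rot: "g (rotate_coord i w x) = g x" for x
    by (simp add: g_def indicator_def norm_rot)
  have [measurable]: "g \<in> borel_measurable borel"
    unfolding g_def divide_ennreal_def
    by (intro borel_measurable_times_ennreal borel_measurable_indicator borel_measurable_const) simp
  have rot_sgn: "rotate_coord i w (sgn x) = sgn (rotate_coord i w x)" for x
    by (simp add: sgn_div_norm norm_rot) (simp add: rotate_coord_def vec_eq_iff)
  have "distr (density lborel g) borel (rotate_coord i w) = density (distr lborel borel (rotate_coord i w)) g"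
    by (subst density_distr) (auto simp: g_rot)
  also have "\<dots> = density lborel g" by (simp add: lborel_rotate_coord[OF w])
  finally have 1: "distr (density lborel g) borel (rotate_coord i w) = density lborel g" .
  have "distr sphere_measure borel (rotate_coord i w) = distr (density lborel g) borel (\<lambda>x. rotate_coord i w (sgn x))"
    unfolding sphere_measure_def unif by (subst distr_distr) (auto simp: comp_def)
  also have "\<dots> = distr (distr (density lborel g) borel (rotate_coord i w)) borel sgn"
    by (subst distr_distr) (auto simp: comp_def rot_sgn)
  also have "\<dots> = sphere_measure" unfolding 1 by (simp add: sphere_measure_def unif)
  finally show ?thesis .
qed

lemma L2S_inner_monom_fun:
  "L2S_inner (monom_fun \<alpha>) (monom_fun \<beta>) = (if \<alpha> = \<beta> then of_real (mom (\<alpha> :: 'n::finite \<Rightarrow> nat)) else 0)"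
proof (cases "\<alpha> = \<beta>")
  case True
  have "L2S_inner (monom_fun \<alpha>) (monom_fun \<alpha>) = (\<integral>z. of_real ((cmod (monom_fun \<alpha> z))\<^sup>2) \<partial>sphere_measure)"
    unfolding L2S_inner_def by (simp add: complex_norm_square flip: of_real_power)
  also have "\<dots> = of_real (mom \<alpha>)"
    unfolding mom_def L2S_normsq_def by (rule integral_complex_of_real)
  finally show ?thesis using True by simp
next
  case False
  then obtain i where i: "\<alpha> i \<noteq> \<beta> i" by auto
  define d where "d = real (\<alpha> i) - real (\<beta> i)"
  \<comment> \<open>Chosen so that \<open>t * d\<close> is pi/2 or -pi/2: the factor
    \<open>u\<close> that the rotation contributes to the integral is then purely imaginary, hence
    not 1, and invariance forces the integral to be 0. Since |d| is at least 1, the angle is at most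
    pi/2 and \<open>w\<close> is not -1.\<close>
  define t where "t = pi / (2 * \<bar>d\<bar>)"
  have d: "\<bar>d\<bar> \<ge> 1" using i unfolding d_def by linarith
  have t: "t > 0" "t \<le> pi / 2"
    using d by (auto simp: t_def field_simps)
  define w where "w = cis t"
  have "Re w \<ge> 0" using t by (auto simp: w_def intro!: cos_ge_zero)
  hence w: "cmod w = 1" "w \<noteq> -1" by (auto simp: w_def complex_eq_iff)
  define u where "u = w ^ \<alpha> i * cnj w ^ \<beta> i"
  have "u = cis (real (\<alpha> i) * t + real (\<beta> i) * (- t))"
    unfolding u_def w_def cis_cnj Complex.DeMoivre cis_mult ..
  also have "real (\<alpha> i) * t + real (\<beta> i) * (- t) = t * d" by (simp add: d_def algebra_simps)
  finally have "u = cis (t * d)" .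
  have "d > 0 \<or> d < 0" using d by linarith
  hence "t * d = pi / 2 \<or> t * d = - (pi / 2)" by (auto simp: t_def)
  hence "cos (t * d) = 0" by (elim disjE) (simp_all only: cos_minus cos_pi_half)
  hence "Re u = 0" unfolding \<open>u = cis (t * d)\<close> by simp
  hence u: "u \<noteq> 1" by auto
  define F where "F z = monom_fun \<alpha> z * cnj (monom_fun \<beta> z)" for z :: "complex^'n"
  have [measurable]: "F \<in> borel_measurable borel" unfolding F_def
    by (intro borel_measurable_times measurable_monom_fun measurable_cnj_monom_fun)
  have mono: "monom_fun \<gamma> (rotate_coord i w z) = w ^ \<gamma> i * monom_fun \<gamma> z" for \<gamma> and z :: "complex^'n"
  proof -
    have *: "monom_fun \<gamma> z = (z $ i) ^ \<gamma> i * (\<Prod>k\<in>UNIV - {i}. (z$k) ^ \<gamma> k)" for z :: "complex^'n"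
      unfolding monom_fun_def by (rule prod.remove) auto
    have "(\<Prod>k\<in>UNIV - {i}. (rotate_coord i w z$k) ^ \<gamma> k) = (\<Prod>k\<in>UNIV - {i}. (z$k) ^ \<gamma> k)"
      by (intro prod.cong) (auto simp: rotate_coord_def)
    thus ?thesis by (simp add: * rotate_coord_def power_mult_distrib)
  qed
  have "(\<integral>z. F z \<partial>sphere_measure) = (\<integral>z. F z \<partial>distr sphere_measure borel (rotate_coord i w))"
    by (simp add: distr_sphere_measure_rotate_coord[OF w])
  also have "\<dots> = (\<integral>z. u * F z \<partial>sphere_measure)"
    by (subst integral_distr) (auto simp: F_def mono u_def mult_ac)
  also have "\<dots> = u * (\<integral>z. F z \<partial>sphere_measure)" by simp
  finally have "(\<integral>z. F z \<partial>sphere_measure) = 0" using u by simp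
  thus ?thesis using False by (simp add: L2S_inner_def F_def)
qed

section \<open>Multiplication operators and their adjoints\<close>

lemma finite_mdeg [simp]: "finite {\<alpha> :: 'n::finite \<Rightarrow> nat. mdeg \<alpha> = k}"
proof (rule finite_subset)
  show "{\<alpha> :: 'n \<Rightarrow> nat. mdeg \<alpha> = k} \<subseteq> PiE UNIV (\<lambda>_. {..k})"
    by (auto simp: mdeg_def intro!: member_le_sum)
qed (auto intro: finite_PiE)

lemma L2S_inner_hom_part:
  "L2S_inner (hom_part f k) (hom_part g k) = (\<Sum>\<alpha> | mdeg \<alpha> = k. of_real (mom \<alpha>) * f \<alpha> * cnj (g \<alpha>))"
proof -
  let ?A = "{\<alpha> :: 'a \<Rightarrow> nat. mdeg \<alpha> = k}"
  have "L2S_inner (hom_part f k) (hom_part g k)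
      = (\<integral>z. (\<Sum>\<alpha>\<in>?A. \<Sum>\<beta>\<in>?A. f \<alpha> * cnj (g \<beta>) * (monom_fun \<alpha> z * cnj (monom_fun \<beta> z))) \<partial>sphere_measure)"
    unfolding L2S_inner_def hom_part_def cnj_sum sum_product
    by (intro Bochner_Integration.integral_cong sum.cong) (auto simp: mult_ac)
  also have "\<dots> = (\<Sum>\<alpha>\<in>?A. \<Sum>\<beta>\<in>?A. f \<alpha> * cnj (g \<beta>) * L2S_inner (monom_fun \<alpha>) (monom_fun \<beta>))"
    unfolding L2S_inner_def
    by (subst Bochner_Integration.integral_sum, intro Bochner_Integration.integrable_sum integrable_mult_right integrable_monom_fun_mult,
        subst Bochner_Integration.integral_sum, intro integrable_mult_right integrable_monom_fun_mult) simp
  also have "\<dots> = (\<Sum>\<alpha>\<in>?A. of_real (mom \<alpha>) * f \<alpha> * cnj (g \<alpha>))"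
    by (intro sum.cong refl) (simp add: L2S_inner_monom_fun if_distrib mult_ac cong: if_cong)
  finally show ?thesis .
qed

lemma L2S_normsq_hom_part:
  "L2S_normsq (hom_part f k) = (\<Sum>\<alpha> | mdeg \<alpha> = k. mom \<alpha> * (cmod (f \<alpha>))\<^sup>2)"
proof -
  have "complex_of_real (L2S_normsq (hom_part f k)) = L2S_inner (hom_part f k) (hom_part f k)"
    unfolding L2S_normsq_def L2S_inner_def integral_complex_of_real[symmetric]
    by (simp add: complex_norm_square flip: of_real_power)
  also have "\<dots> = of_real (\<Sum>\<alpha> | mdeg \<alpha> = k. mom \<alpha> * (cmod (f \<alpha>))\<^sup>2)"
    unfolding L2S_inner_hom_part of_real_sum
    by (intro sum.cong refl) (simp add: complex_norm_square mult.assoc del: of_real_power)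
  finally show ?thesis unfolding of_real_eq_iff .
qed

section \<open>The space in monomial coordinates\<close>

text \<open>The squared norm of the monomial \<alpha> in the weighted space.\<close>

definition wt :: "(nat \<Rightarrow> real) \<Rightarrow> ('n::finite \<Rightarrow> nat) \<Rightarrow> real" where
  "wt b \<alpha> = (b (mdeg \<alpha>))\<^sup>2 * mom \<alpha>"

definition sqpart :: "(nat \<Rightarrow> real) \<Rightarrow> 'n::finite fps \<Rightarrow> nat \<Rightarrow> real" where
  "sqpart b f k = (\<Sum>\<alpha> | mdeg \<alpha> = k. wt b \<alpha> * (cmod (f \<alpha>))\<^sup>2)"

lemma sqpart_eq: "sqpart b f k = (b k)\<^sup>2 * L2S_normsq (hom_part f k)"
  unfolding sqpart_def L2S_normsq_hom_part sum_distrib_left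
  by (intro sum.cong) (auto simp: wt_def)

lemma Hb_space_iff: "f \<in> Hb_space b \<longleftrightarrow> summable (sqpart b f)"
  by (simp add: Hb_space_def sqpart_eq[abs_def])

lemma Hb_norm_eq: "Hb_norm b f = sqrt (suminf (sqpart b f))"
  by (simp add: Hb_norm_def sqpart_eq[abs_def])

lemma Hb_inner_eq:
  "Hb_inner b f g = (\<Sum>k. \<Sum>\<alpha> | mdeg \<alpha> = k. of_real (wt b \<alpha>) * f \<alpha> * cnj (g \<alpha>))"
  unfolding Hb_inner_def L2S_inner_hom_part sum_distrib_left
  by (intro suminf_cong sum.cong) (auto simp: wt_def mult_ac)

lemma wt_nonneg: "wt b \<alpha> \<ge> 0"
  by (simp add: wt_def mom_nonneg)

lemma sqpart_nonneg: "sqpart b f k \<ge> 0"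
  unfolding sqpart_def by (intro sum_nonneg) (simp add: wt_nonneg)

lemma Hb_norm_nonneg: "f \<in> Hb_space b \<Longrightarrow> Hb_norm b f \<ge> 0"
  by (simp add: Hb_norm_eq Hb_space_iff suminf_nonneg sqpart_nonneg)

text \<open>The commutators preserve degree, so operator bounds for them can be checked one degree
  at a time.\<close>

lemma Hb_space_bound:
  assumes "f \<in> Hb_space b" "C \<ge> 0" and le: "\<And>k. sqpart b g k \<le> C\<^sup>2 * sqpart b f k"
  shows "g \<in> Hb_space b" "Hb_norm b g \<le> C * Hb_norm b f"
proof -
  have sf: "summable (\<lambda>k. C\<^sup>2 * sqpart b f k)" using assms by (simp add: Hb_space_iff)
  show g: "g \<in> Hb_space b"
    unfolding Hb_space_iff
    by (rule summable_comparison_test'[OF sf]) (use le sqpart_nonneg[of b g] in auto)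
  have "suminf (sqpart b g) \<le> (\<Sum>k. C\<^sup>2 * sqpart b f k)"
    using g sf le by (intro suminf_le) (auto simp: Hb_space_iff)
  also have "\<dots> = C\<^sup>2 * suminf (sqpart b f)"
    using assms(1) by (intro suminf_mult) (simp add: Hb_space_iff)
  finally have "sqrt (suminf (sqpart b g)) \<le> sqrt (C\<^sup>2 * suminf (sqpart b f))" by simp
  thus "Hb_norm b g \<le> C * Hb_norm b f" using \<open>C \<ge> 0\<close> by (simp add: Hb_norm_eq real_sqrt_mult)
qed

lemma Hb_space_lin:
  assumes f: "f \<in> Hb_space b" and g: "g \<in> Hb_space b"
  shows "(\<lambda>\<alpha>. c * f \<alpha> + g \<alpha>) \<in> Hb_space b"
proof -
  have le: "sqpart b (\<lambda>\<alpha>. c * f \<alpha> + g \<alpha>) k \<le> 2 * (cmod c)\<^sup>2 * sqpart b f k + 2 * sqpart b g k" for k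
  proof -
    have *: "(cmod (c * x + y))\<^sup>2 \<le> 2 * (cmod c)\<^sup>2 * (cmod x)\<^sup>2 + 2 * (cmod y)\<^sup>2" for x y
    proof -
      have "(cmod (c * x + y))\<^sup>2 \<le> (cmod (c * x) + cmod y)\<^sup>2"
        by (intro power_mono norm_triangle_ineq) auto
      also have "\<dots> \<le> 2 * (cmod (c * x))\<^sup>2 + 2 * (cmod y)\<^sup>2"
        using sum_squares_bound[of "cmod (c * x)" "cmod y"] by (simp add: power2_sum)
      finally show ?thesis by (simp add: norm_mult power_mult_distrib)
    qed
    have "sqpart b (\<lambda>\<alpha>. c * f \<alpha> + g \<alpha>) k \<le>
      (\<Sum>\<alpha> | mdeg \<alpha> = k. wt b \<alpha> * (2 * (cmod c)\<^sup>2 * (cmod (f \<alpha>))\<^sup>2 + 2 * (cmod (g \<alpha>))\<^sup>2))"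
      unfolding sqpart_def by (intro sum_mono mult_left_mono * wt_nonneg)
    also have "\<dots> = 2 * (cmod c)\<^sup>2 * sqpart b f k + 2 * sqpart b g k"
      unfolding sqpart_def by (simp add: algebra_simps sum.distrib sum_distrib_left)
    finally show ?thesis .
  qed
  have sm: "summable (\<lambda>k. 2 * (cmod c)\<^sup>2 * sqpart b f k + 2 * sqpart b g k)"
    using f g by (intro summable_add summable_mult) (auto simp: Hb_space_iff)
  show ?thesis
    unfolding Hb_space_iff
    by (rule summable_comparison_test'[OF sm])
       (unfold real_norm_def abs_of_nonneg[OF sqpart_nonneg], rule le)
qed

lemma Hb_space_0: "(\<lambda>_. 0) \<in> Hb_space b"
  by (simp add: Hb_space_iff sqpart_def[abs_def])

lemma Hb_space_finite_support:
  assumes "finite G" and "\<And>\<alpha>. \<alpha> \<notin> G \<Longrightarrow> f \<alpha> = 0"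
  shows "f \<in> Hb_space b"
  unfolding Hb_space_iff
proof (rule summable_finite)
  show "finite (mdeg ` G)" using assms by simp
  show "sqpart b f k = 0" if "k \<notin> mdeg ` G" for k
    unfolding sqpart_def using that assms(2) by (intro sum.neutral) auto
qed

definition unit_mon :: "('n \<Rightarrow> nat) \<Rightarrow> 'n fps" where
  "unit_mon \<alpha> = (\<lambda>\<beta>. if \<beta> = \<alpha> then 1 else 0)"

lemma unit_mon_Hb_space: "unit_mon \<alpha> \<in> Hb_space b"
  by (rule Hb_space_finite_support[of "{\<alpha>}"]) (auto simp: unit_mon_def)

text \<open>Justifies splitting off the degree 0 term of the series when the adjoint of
  \<open>Mz j\<close> is computed.\<close>

lemma Hb_inner_summable:
  assumes f: "f \<in> Hb_space b" and g: "g \<in> Hb_space b"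
  shows "summable (\<lambda>k. \<Sum>\<alpha> | mdeg \<alpha> = k. of_real (wt b \<alpha>) * f \<alpha> * cnj (g \<alpha>))"
proof (rule summable_comparison_test')
  show "summable (\<lambda>k. sqpart b f k + sqpart b g k)"
    using f g by (intro summable_add) (auto simp: Hb_space_iff)
  fix k
  have "cmod (\<Sum>\<alpha> | mdeg \<alpha> = k. of_real (wt b \<alpha>) * f \<alpha> * cnj (g \<alpha>))
     \<le> (\<Sum>\<alpha> | mdeg \<alpha> = k. wt b \<alpha> * ((cmod (f \<alpha>))\<^sup>2 + (cmod (g \<alpha>))\<^sup>2))"
  proof (rule sum_norm_le)
    fix \<alpha>
    have "cmod (f \<alpha>) * cmod (g \<alpha>) \<le> (cmod (f \<alpha>))\<^sup>2 + (cmod (g \<alpha>))\<^sup>2"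
      using sum_squares_bound[of "cmod (f \<alpha>)" "cmod (g \<alpha>)"]
        mult_nonneg_nonneg[OF norm_ge_zero norm_ge_zero, of "f \<alpha>" "g \<alpha>"] by linarith
    thus "cmod (of_real (wt b \<alpha>) * f \<alpha> * cnj (g \<alpha>)) \<le> wt b \<alpha> * ((cmod (f \<alpha>))\<^sup>2 + (cmod (g \<alpha>))\<^sup>2)"
      using wt_nonneg[of b \<alpha>] by (auto simp: norm_mult mult.assoc intro: mult_left_mono)
  qed
  thus "cmod (\<Sum>\<alpha> | mdeg \<alpha> = k. of_real (wt b \<alpha>) * f \<alpha> * cnj (g \<alpha>)) \<le> sqpart b f k + sqpart b g k"
    by (simp add: sqpart_def sum.distrib distrib_left)
qed

text \<open>Pairing with monomials recovers every coefficient of \<open>h\<close>; this gives the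
  uniqueness required by the \<open>THE\<close> in \<open>Hb_adj\<close>.\<close>

lemma Hb_inner_unit_mon: "Hb_inner b (unit_mon \<alpha>) h = of_real (wt b \<alpha>) * cnj (h \<alpha>)"
proof -
  have "(\<Sum>\<beta> | mdeg \<beta> = k. of_real (wt b \<beta>) * unit_mon \<alpha> \<beta> * cnj (h \<beta>))
      = (if k = mdeg \<alpha> then of_real (wt b \<alpha>) * cnj (h \<alpha>) else 0)" for k
    by (simp add: unit_mon_def if_distrib if_distribR sum.delta cong: if_cong)
  hence "Hb_inner b (unit_mon \<alpha>) h = (\<Sum>k. if k = mdeg \<alpha> then of_real (wt b \<alpha>) * cnj (h \<alpha>) else 0)"
    by (simp add: Hb_inner_eq)
  also have "\<dots> = of_real (wt b \<alpha>) * cnj (h \<alpha>)"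
    using sums_single[of "mdeg \<alpha>" "\<lambda>_. of_real (wt b \<alpha>) * cnj (h \<alpha>)"] by (simp add: sums_iff)
  finally show ?thesis .
qed

lemma dec_inc: "\<beta> j \<noteq> 0 \<Longrightarrow> inc (\<beta>(j := \<beta> j - 1)) j = \<beta>"
  by auto

text \<open>Multiplication by z_j maps the monomials of degree k bijectively onto those of degree
  k+1 divisible by z_j. The computations for \<open>Mz j\<close> and for its adjoint both rest on
  this reindexing.\<close>

lemma sum_inc:
  fixes j :: "'n::finite"
  shows "(\<Sum>\<beta> | mdeg \<beta> = Suc k \<and> \<beta> j \<noteq> 0. G \<beta>) = (\<Sum>\<alpha> | mdeg \<alpha> = k. G (inc \<alpha> j))"
proof (rule sum.reindex_bij_witness[of _ "\<lambda>\<alpha>. inc \<alpha> j" "\<lambda>\<beta>. \<beta>(j := \<beta> j - 1)"])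
  fix \<beta> assume "\<beta> \<in> {\<beta> :: 'n \<Rightarrow> nat. mdeg \<beta> = Suc k \<and> \<beta> j \<noteq> 0}"
  hence \<beta>: "mdeg \<beta> = Suc k" "\<beta> j \<noteq> 0" by auto
  show "inc (\<beta>(j := \<beta> j - 1)) j = \<beta>" using \<beta> by auto
  thus "G (inc (\<beta>(j := \<beta> j - 1)) j) = G \<beta>" by simp
  have "mdeg (inc (\<beta>(j := \<beta> j - 1)) j) = Suc k" unfolding dec_inc[of \<beta> j, OF \<beta>(2)] by (rule \<beta>(1))
  thus "\<beta>(j := \<beta> j - 1) \<in> {\<alpha>. mdeg \<alpha> = k}" unfolding mdeg_inc by simp
qed auto

section \<open>Multiplication operators and their adjoints\<close>

text \<open>The bound \<open>D\<close> makes every \<open>Mz j\<close> a bounded operator on the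
  space, so that \<open>Hb_adj\<close> describes a genuine adjoint.\<close>

locale weighted =
  fixes b :: "nat \<Rightarrow> real" and D :: real
  assumes bpos: "\<And>k. b k > 0" and delta_le: "\<And>k. delta b k \<le> D"
begin

lemma delta_pos: "delta b k > 0"
  by (simp add: delta_def bpos)

lemma wt_pos: "wt b \<alpha> > 0"
  unfolding wt_def using bpos[of "mdeg \<alpha>"] mom_pos[of \<alpha>] by simp

text \<open>The ratio of the squared norms of z^(\<alpha>+e_j) and z^\<alpha>, see
  \<open>wt_inc\<close>; hence also the coefficient in the adjoint of \<open>Mz j\<close>.\<close>

definition rho :: "'n \<Rightarrow> ('n::finite \<Rightarrow> nat) \<Rightarrow> real" where
  "rho j \<alpha> = (delta b (mdeg \<alpha>))\<^sup>2 * real (Suc (\<alpha> j)) / real (mdeg \<alpha> + CARD('n))"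

lemma wt_inc: "wt b (inc \<alpha> j) = rho j \<alpha> * wt b (\<alpha> :: 'n::finite \<Rightarrow> nat)"
proof -
  have pos: "real (mdeg \<alpha> + CARD('n)) > 0" by (simp add: add_nonneg_pos)
  have "mom (inc \<alpha> j) = real (Suc (\<alpha> j)) * mom \<alpha> / real (mdeg \<alpha> + CARD('n))"
    using mom_inc[of \<alpha> j] pos by (metis nonzero_mult_div_cancel_left less_irrefl)
  moreover have "b (Suc (mdeg \<alpha>)) = delta b (mdeg \<alpha>) * b (mdeg \<alpha>)"
    using bpos[of "mdeg \<alpha>"] by (simp add: delta_def)
  ultimately show ?thesis
    unfolding wt_def mdeg_inc rho_def by (simp add: power_mult_distrib)
qed

lemma rho_nonneg: "rho j \<alpha> \<ge> 0"
  by (simp add: rho_def)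

lemma le_mdeg: "\<alpha> j \<le> mdeg (\<alpha> :: 'n::finite \<Rightarrow> nat)"
  unfolding mdeg_def by (rule member_le_sum) auto

lemma rho_le: "rho j (\<alpha> :: 'n::finite \<Rightarrow> nat) \<le> D\<^sup>2"
proof -
  have "real (Suc (\<alpha> j)) / real (mdeg \<alpha> + CARD('n)) \<le> 1"
  proof -
    have "CARD('n) > 0" by simp
    hence "Suc (\<alpha> j) \<le> mdeg \<alpha> + CARD('n)" using le_mdeg[of \<alpha> j] by linarith
    thus ?thesis by (simp add: divide_le_eq_1 del: of_nat_add of_nat_Suc)
  qed
  hence "rho j \<alpha> \<le> (delta b (mdeg \<alpha>))\<^sup>2 * 1"
    unfolding rho_def times_divide_eq_right[symmetric] by (intro mult_left_mono) auto
  also have "\<dots> \<le> D\<^sup>2"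
    using delta_pos[of "mdeg \<alpha>"] delta_le[of "mdeg \<alpha>"] by (simp add: power_mono)
  finally show ?thesis .
qed

lemma Mz_inc: "Mz j f (inc \<alpha> j) = f \<alpha>"
  by (simp add: Mz_def)

text \<open>\<open>G\<close> is abstract so that one reindexing serves both squared norms and inner
  products; \<open>G \<beta> 0 = 0\<close> discards the monomials not divisible by z_j.\<close>

lemma sum_Mz:
  fixes G :: "('n::finite \<Rightarrow> nat) \<Rightarrow> complex \<Rightarrow> 'c::comm_monoid_add"
  assumes "\<And>\<beta>. G \<beta> 0 = 0"
  shows "(\<Sum>\<beta> | mdeg \<beta> = 0. G \<beta> (Mz j f \<beta>)) = 0"
    and "(\<Sum>\<beta> | mdeg \<beta> = Suc k. G \<beta> (Mz j f \<beta>)) = (\<Sum>\<alpha> | mdeg \<alpha> = k. G (inc \<alpha> j) (f \<alpha>))"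
proof -
  show "(\<Sum>\<beta> | mdeg \<beta> = 0. G \<beta> (Mz j f \<beta>)) = 0"
  proof (intro sum.neutral ballI)
    fix \<beta> assume "\<beta> \<in> {\<beta> :: 'n \<Rightarrow> nat. mdeg \<beta> = 0}"
    thus "G \<beta> (Mz j f \<beta>) = 0" using le_mdeg[of \<beta> j] by (simp add: Mz_def assms)
  qed
  have "(\<Sum>\<beta> | mdeg \<beta> = Suc k. G \<beta> (Mz j f \<beta>)) = (\<Sum>\<beta> | mdeg \<beta> = Suc k \<and> \<beta> j \<noteq> 0. G \<beta> (Mz j f \<beta>))"
    by (intro sum.mono_neutral_right) (auto simp: Mz_def assms)
  also have "\<dots> = (\<Sum>\<alpha> | mdeg \<alpha> = k. G (inc \<alpha> j) (f \<alpha>))"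
    unfolding sum_inc Mz_inc ..
  finally show "(\<Sum>\<beta> | mdeg \<beta> = Suc k. G \<beta> (Mz j f \<beta>)) = (\<Sum>\<alpha> | mdeg \<alpha> = k. G (inc \<alpha> j) (f \<alpha>))" .
qed

lemma Mz_Hb_space:
  assumes "f \<in> Hb_space b"
  shows "Mz j f \<in> Hb_space b"
proof -
  have "summable (\<lambda>k. sqpart b (Mz j f) (Suc k))"
  proof (rule summable_comparison_test')
    show "summable (\<lambda>k. D\<^sup>2 * sqpart b f k)" using assms by (simp add: Hb_space_iff)
    fix k
    have "sqpart b (Mz j f) (Suc k) = (\<Sum>\<alpha> | mdeg \<alpha> = k. wt b (inc \<alpha> j) * (cmod (f \<alpha>))\<^sup>2)"
      unfolding sqpart_def by (rule sum_Mz(2)) simp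
    also have "\<dots> \<le> (\<Sum>\<alpha> | mdeg \<alpha> = k. D\<^sup>2 * (wt b \<alpha> * (cmod (f \<alpha>))\<^sup>2))"
      unfolding wt_inc mult.assoc by (intro sum_mono mult_right_mono rho_le) (simp add: wt_nonneg)
    finally show "norm (sqpart b (Mz j f) (Suc k)) \<le> D\<^sup>2 * sqpart b f k"
      unfolding sqpart_def[of b f] by (simp add: sum_distrib_left sqpart_nonneg)
  qed
  thus ?thesis unfolding Hb_space_iff by (simp add: summable_Suc_iff)
qed

lemma adjoint_Hb_space:
  assumes "g \<in> Hb_space b"
  shows "(\<lambda>\<alpha>. of_real (rho j \<alpha>) * g (inc \<alpha> j)) \<in> Hb_space b"
  unfolding Hb_space_iff
proof (rule summable_comparison_test')
  let ?h = "\<lambda>\<alpha>. of_real (rho j \<alpha>) * g (inc \<alpha> j)"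
  show "summable (\<lambda>k. D\<^sup>2 * sqpart b g (Suc k))"
    using assms by (simp add: Hb_space_iff summable_Suc_iff)
  fix k
  \<comment> \<open>Of the two factors \<open>rho j \<alpha>\<close>, one turns
    \<open>wt b \<alpha>\<close> into the weight of the incremented index and the other is bounded
    by \<open>D\<^sup>2\<close>.\<close>
  have "sqpart b ?h k = (\<Sum>\<alpha> | mdeg \<alpha> = k. rho j \<alpha> * (wt b (inc \<alpha> j) * (cmod (g (inc \<alpha> j)))\<^sup>2))"
    unfolding sqpart_def wt_inc
    by (intro sum.cong refl) (simp add: norm_mult power_mult_distrib power2_eq_square mult_ac rho_nonneg)
  also have "\<dots> \<le> (\<Sum>\<alpha> | mdeg \<alpha> = k. D\<^sup>2 * (wt b (inc \<alpha> j) * (cmod (g (inc \<alpha> j)))\<^sup>2))"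
    by (intro sum_mono mult_right_mono rho_le) (simp add: wt_nonneg)
  also have "\<dots> = D\<^sup>2 * (\<Sum>\<beta> | mdeg \<beta> = Suc k \<and> \<beta> j \<noteq> 0. wt b \<beta> * (cmod (g \<beta>))\<^sup>2)"
    unfolding sum_inc sum_distrib_left ..
  also have "\<dots> \<le> D\<^sup>2 * sqpart b g (Suc k)"
    unfolding sqpart_def by (intro mult_left_mono sum_mono2) (auto simp: wt_nonneg)
  finally show "norm (sqpart b ?h k) \<le> D\<^sup>2 * sqpart b g (Suc k)"
    by (simp add: sqpart_nonneg)
qed

text \<open>Shifting the summation index moves z_j from one side of the inner product to the other,
  and the quotient of the weights is \<open>rho j \<alpha>\<close>. Uniqueness follows by testing
  with monomials, whose weights are nonzero.\<close>

lemma Hb_adj_Mz: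
  fixes g :: "'n::finite fps"
  assumes g: "g \<in> Hb_space b"
  shows "Hb_adj b (Mz j) g = (\<lambda>\<alpha>. of_real (rho j \<alpha>) * g (inc \<alpha> j))"
  unfolding Hb_adj_def
proof (rule the_equality)
  let ?h = "\<lambda>\<alpha>. of_real (rho j \<alpha>) * g (inc \<alpha> j)"
  have eq: "Hb_inner b (Mz j f) g = Hb_inner b f ?h" if f: "f \<in> Hb_space b" for f
  proof -
    let ?a = "\<lambda>k. \<Sum>\<beta> | mdeg \<beta> = k. of_real (wt b \<beta>) * Mz j f \<beta> * cnj (g \<beta>)"
    have a_Suc: "?a (Suc k) = (\<Sum>\<alpha> | mdeg \<alpha> = k. of_real (wt b \<alpha>) * f \<alpha> * cnj (?h \<alpha>))" for k
    proof -
      have "?a (Suc k) = (\<Sum>\<alpha> | mdeg \<alpha> = k. of_real (wt b (inc \<alpha> j)) * f \<alpha> * cnj (g (inc \<alpha> j)))"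
        by (rule sum_Mz(2)) simp
      thus ?thesis unfolding wt_inc by (simp add: mult_ac)
    qed
    have "Hb_inner b (Mz j f) g = suminf ?a" by (rule Hb_inner_eq)
    also have "\<dots> = ?a 0 + (\<Sum>k. ?a (Suc k))"
      using suminf_split_head[OF Hb_inner_summable[OF Mz_Hb_space[OF f] g]] by simp
    also have "?a 0 = 0"
      by (rule sum_Mz(1)) simp
    finally show ?thesis unfolding a_Suc by (simp add: Hb_inner_eq)
  qed
  show "?h \<in> Hb_space b \<and> (\<forall>f\<in>Hb_space b. Hb_inner b (Mz j f) g = Hb_inner b f ?h)"
    using adjoint_Hb_space[OF g] eq by auto
  fix h :: "'n fps"
  assume h: "h \<in> Hb_space b \<and> (\<forall>f\<in>Hb_space b. Hb_inner b (Mz j f) g = Hb_inner b f h)"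
  show "h = ?h"
  proof
    fix \<alpha>
    have "Hb_inner b (Mz j (unit_mon \<alpha>)) g = Hb_inner b (unit_mon \<alpha>) h"
      using h unit_mon_Hb_space[of \<alpha> b] by blast
    hence "of_real (wt b \<alpha>) * cnj (h \<alpha>) = of_real (wt b \<alpha>) * cnj (?h \<alpha>)"
      unfolding eq[OF unit_mon_Hb_space] Hb_inner_unit_mon by (rule sym)
    moreover have "complex_of_real (wt b \<alpha>) \<noteq> 0" using wt_pos[of \<alpha>] by simp
    ultimately have "cnj (h \<alpha>) = cnj (?h \<alpha>)" unfolding mult_cancel_left by blast
    thus "h \<alpha> = ?h \<alpha>" by (simp only: complex_cnj_cancel_iff)
  qed
qed

text \<open>The truncated \<open>k - 1\<close> makes the value at \<open>k = 0\<close> junk; in the commutators it is multiplied by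
  \<open>\<alpha> j = 0\<close>.\<close>

definition cc :: "'n::finite itself \<Rightarrow> nat \<Rightarrow> real" where
  "cc _ k = (delta b k)\<^sup>2 / (real k + real CARD('n)) - (delta b (k - 1))\<^sup>2 / (real k + real CARD('n) - 1)"

definition dd :: "'n::finite itself \<Rightarrow> nat \<Rightarrow> real" where
  "dd _ k = (delta b k)\<^sup>2 / (real k + real CARD('n))"

lemma rho_eq: "rho j (\<alpha> :: 'n::finite \<Rightarrow> nat) = dd TYPE('n) (mdeg \<alpha>) * (real (\<alpha> j) + 1)"
  by (simp add: rho_def dd_def)

text \<open>The lowered index has degree k - 1, so its coefficient is d_(k-1), rewritten as d_k -
  c_k. Here k is at least 1, so the junk value of \<open>cc\<close> at 0 does not occur.
  \<open>j\<close> and \<open>l\<close> are independent so that both kinds of commutators can use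
  it.\<close>

lemma rho_dec_eq:
  fixes \<alpha> :: "'n::finite \<Rightarrow> nat"
  assumes "\<alpha> l \<noteq> 0"
  shows "rho j (\<alpha>(l := \<alpha> l - 1)) = (dd TYPE('n) (mdeg \<alpha>) - cc TYPE('n) (mdeg \<alpha>)) * (real ((\<alpha>(l := \<alpha> l - 1)) j) + 1)"
proof -
  have "Suc (mdeg (\<alpha>(l := \<alpha> l - 1))) = mdeg \<alpha>"
    using mdeg_inc[of "\<alpha>(l := \<alpha> l - 1)" l] unfolding dec_inc[of \<alpha> l, OF assms] by simp
  hence *: "mdeg (\<alpha>(l := \<alpha> l - 1)) = mdeg \<alpha> - 1" "mdeg \<alpha> \<ge> 1" by linarith+
  have "dd TYPE('n) (mdeg \<alpha>) - cc TYPE('n) (mdeg \<alpha>) = dd TYPE('n) (mdeg \<alpha> - 1)"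
    using *(2) by (simp add: dd_def cc_def of_nat_diff algebra_simps)
  thus ?thesis unfolding rho_eq *(1) by simp
qed

section \<open>Commutators in monomial coordinates\<close>

text \<open>Adjoint after multiplication has the eigenvalue d_k (\<alpha>_j + 1), and multiplication
  after adjoint has d_(k-1) \<alpha>_j = (d_k - c_k) \<alpha>_j.\<close>

lemma comm_diag:
  fixes f :: "'n::finite fps"
  assumes f: "f \<in> Hb_space b"
  shows "comm (Hb_adj b (Mz j)) (Mz j) f \<alpha>
       = of_real (cc TYPE('n) (mdeg \<alpha>) * real (\<alpha> j) + dd TYPE('n) (mdeg \<alpha>)) * f \<alpha>"
proof -
  have "comm (Hb_adj b (Mz j)) (Mz j) f \<alpha>
      = of_real (rho j \<alpha>) * f \<alpha> - (if \<alpha> j = 0 then 0 else of_real (rho j (\<alpha>(j := \<alpha> j - 1))) * f \<alpha>)"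
    unfolding comm_def Hb_adj_Mz[OF f] Hb_adj_Mz[OF Mz_Hb_space[OF f]] Mz_inc
    unfolding Mz_def using dec_inc[of \<alpha> j] by simp
  also have "\<dots> = of_real (cc TYPE('n) (mdeg \<alpha>) * real (\<alpha> j) + dd TYPE('n) (mdeg \<alpha>)) * f \<alpha>"
  proof (cases "\<alpha> j = 0")
    case True
    thus ?thesis by (simp add: rho_eq)
  next
    case False
    have "rho j (\<alpha>(j := \<alpha> j - 1)) = (dd TYPE('n) (mdeg \<alpha>) - cc TYPE('n) (mdeg \<alpha>)) * real (\<alpha> j)"
      using rho_dec_eq[of \<alpha> j j] False by (simp add: of_nat_diff)
    thus ?thesis unfolding rho_eq[of j \<alpha>] using False
      by (simp only: if_False) (simp add: algebra_simps)
  qed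
  finally show ?thesis .
qed

text \<open>The index \<alpha> - e_l + e_j. It has this meaning only for
  \<open>\<alpha> l \<noteq> 0\<close>, where the subtraction is not truncated.\<close>

definition shft :: "'n \<Rightarrow> 'n \<Rightarrow> ('n \<Rightarrow> nat) \<Rightarrow> ('n \<Rightarrow> nat)" where
  "shft j l \<alpha> = inc (\<alpha>(l := \<alpha> l - 1)) j"

text \<open>Both products read the coefficient at \<alpha> - e_l + e_j. As j differs from l,
  lowering coordinate l leaves \<alpha>_j alone, so only the difference d_k - d_(k-1) = c_k
  survives.\<close>

lemma comm_offdiag:
  fixes f :: "'n::finite fps"
  assumes f: "f \<in> Hb_space b" and jl: "j \<noteq> l"
  shows "comm (Hb_adj b (Mz j)) (Mz l) f \<alpha>
       = (if \<alpha> l \<noteq> 0 then of_real (cc TYPE('n) (mdeg \<alpha>) * (real (\<alpha> j) + 1)) * f (shft j l \<alpha>) else 0)"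
proof -
  have upd: "(inc \<alpha> j)(l := (inc \<alpha> j) l - 1) = shft j l \<alpha>"
    using jl by (auto simp: shft_def)
  have "comm (Hb_adj b (Mz j)) (Mz l) f \<alpha> = of_real (rho j \<alpha>) * Mz l f (inc \<alpha> j)
      - Mz l (\<lambda>\<alpha>. of_real (rho j \<alpha>) * f (inc \<alpha> j)) \<alpha>"
    unfolding comm_def Hb_adj_Mz[OF f] Hb_adj_Mz[OF Mz_Hb_space[OF f]] ..
  also have "Mz l f (inc \<alpha> j) = (if \<alpha> l = 0 then 0 else f (shft j l \<alpha>))"
    unfolding Mz_def upd using jl by simp
  also have "Mz l (\<lambda>\<alpha>. of_real (rho j \<alpha>) * f (inc \<alpha> j)) \<alpha>
      = (if \<alpha> l = 0 then 0 else of_real (rho j (\<alpha>(l := \<alpha> l - 1))) * f (shft j l \<alpha>))"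
    unfolding Mz_def shft_def ..
  also have "of_real (rho j \<alpha>) * (if \<alpha> l = 0 then 0 else f (shft j l \<alpha>)) -
     (if \<alpha> l = 0 then 0 else of_real (rho j (\<alpha>(l := \<alpha> l - 1))) * f (shft j l \<alpha>))
     = (if \<alpha> l \<noteq> 0 then of_real (rho j \<alpha> - rho j (\<alpha>(l := \<alpha> l - 1))) * f (shft j l \<alpha>) else 0)"
    by (simp add: algebra_simps)
  finally have *: "comm (Hb_adj b (Mz j)) (Mz l) f \<alpha> =
     (if \<alpha> l \<noteq> 0 then of_real (rho j \<alpha> - rho j (\<alpha>(l := \<alpha> l - 1))) * f (shft j l \<alpha>) else 0)" .
  have "rho j \<alpha> - rho j (\<alpha>(l := \<alpha> l - 1)) = cc TYPE('n) (mdeg \<alpha>) * (real (\<alpha> j) + 1)" if "\<alpha> l \<noteq> 0"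
    unfolding rho_dec_eq[of \<alpha> l, OF that] unfolding rho_eq using jl by (simp add: algebra_simps)
  thus ?thesis unfolding * by (cases "\<alpha> l = 0") (simp_all only: if_True if_False simp_thms not_True_eq_False not_False_eq_True)
qed

lemma mdeg_shft: 
  assumes "\<alpha> l \<noteq> 0"
  shows "mdeg (shft j l \<alpha>) = mdeg (\<alpha> :: 'n::finite \<Rightarrow> nat)"
  using mdeg_inc[of "\<alpha>(l := \<alpha> l - 1)" l] unfolding dec_inc[of \<alpha> l, OF assms] shft_def mdeg_inc by simp

text \<open>Both indices arise from \<alpha> - e_l by raising one coordinate. The factor depending
  on the degree is common, so the two weights are in the ratio \<alpha>_l to \<alpha>_j + 1.\<close>

lemma wt_shft:
  fixes \<alpha> :: "'n::finite \<Rightarrow> nat"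
  assumes l: "\<alpha> l \<noteq> 0" and jl: "j \<noteq> l"
  shows "(real (\<alpha> j) + 1) * wt b \<alpha> = real (\<alpha> l) * wt b (shft j l \<alpha>)"
proof -
  define \<beta> where "\<beta> = \<alpha>(l := \<alpha> l - 1)"
  have \<alpha>: "\<alpha> = inc \<beta> l" using l by (auto simp: \<beta>_def)
  have "real (\<alpha> l) * wt b (shft j l \<alpha>) = dd TYPE('n) (mdeg \<beta>) * (real (\<alpha> j) + 1) * real (\<alpha> l) * wt b \<beta>"
    unfolding shft_def \<beta>_def[symmetric] wt_inc rho_eq using jl by (simp add: \<beta>_def)
  also have "dd TYPE('n) (mdeg \<beta>) * (real (\<alpha> j) + 1) * real (\<alpha> l) * wt b \<beta> = (real (\<alpha> j) + 1) * wt b \<alpha>"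
    unfolding \<alpha> wt_inc rho_eq by simp
  finally show ?thesis ..
qed

lemma inj_on_shft: "j \<noteq> l \<Longrightarrow> inj_on (shft j l) {\<alpha>. \<alpha> l \<noteq> 0}"
proof (rule inj_onI)
  fix \<alpha> \<beta> assume jl: "j \<noteq> l" and "\<alpha> \<in> {\<alpha>. \<alpha> l \<noteq> 0}" "\<beta> \<in> {\<alpha>. \<alpha> l \<noteq> 0}" and eq: "shft j l \<alpha> = shft j l \<beta>"
  show "\<alpha> = \<beta>"
  proof
    fix i
    from fun_cong[OF eq, of i] fun_cong[OF eq, of l] fun_cong[OF eq, of j]
    show "\<alpha> i = \<beta> i"
      using jl \<open>\<alpha> \<in> _\<close> \<open>\<beta> \<in> _\<close> by (auto simp: shft_def split: if_splits)
  qed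
qed

end

section \<open>Singular numbers\<close>

text \<open>Gaussian elimination with more unknowns than equations. It will provide a nonzero
  combination of more than n monomials that is annihilated by a given operator of rank at most
  n.\<close>

lemma homogeneous_system_nontrivial:
  fixes A :: "'a \<Rightarrow> nat \<Rightarrow> 'f::field"
  assumes "finite G" "n < card G"
  shows "\<exists>x. (\<exists>g\<in>G. x g \<noteq> 0) \<and> (\<forall>i<n. (\<Sum>g\<in>G. x g * A g i) = 0)"
  using assms
proof (induction n arbitrary: G A)
  case 0
  hence "G \<noteq> {}" by auto
  thus ?case by (intro exI[of _ "\<lambda>_. 1"]) auto
next
  case (Suc n)
  show ?case
  proof (cases "\<forall>g\<in>G. A g n = 0")
    case True
    obtain x where "\<exists>g\<in>G. x g \<noteq> 0" "\<forall>i<n. (\<Sum>g\<in>G. x g * A g i) = 0"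
      using Suc.IH[of G A] Suc.prems by auto
    thus ?thesis using True by (intro exI[of _ x]) (auto simp: less_Suc_eq)
  next
    case False
    then obtain h where h: "h \<in> G" "A h n \<noteq> 0" by auto
    define G' where "G' = G - {h}"
    have G': "finite G'" "n < card G'" "h \<notin> G'" "G = insert h G'"
      using Suc.prems h by (auto simp: G'_def)
    obtain x where x: "\<exists>g\<in>G'. x g \<noteq> 0" "\<And>i. i < n \<Longrightarrow> (\<Sum>g\<in>G'. x g * (A g i - A g n / A h n * A h i)) = 0"
      using Suc.IH[of G' "\<lambda>g i. A g i - A g n / A h n * A h i"] G' by auto
    \<comment> \<open>Back substitution: the last equation is solved for the eliminated unknown
      \<open>h\<close>.\<close>
    define y where "y = x(h := - (\<Sum>g\<in>G'. x g * A g n) / A h n)"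
    have eq: "(\<Sum>g\<in>G. y g * A g i) = (\<Sum>g\<in>G'. x g * (A g i - A g n / A h n * A h i))" for i
    proof -
      have "(\<Sum>g\<in>G. y g * A g i) = y h * A h i + (\<Sum>g\<in>G'. y g * A g i)"
        unfolding G'(4) using G'(1,3) by (rule sum.insert)
      also have "(\<Sum>g\<in>G'. y g * A g i) = (\<Sum>g\<in>G'. x g * A g i)"
        using G'(3) by (intro sum.cong) (auto simp: y_def)
      finally show ?thesis
        by (simp add: y_def right_diff_distrib sum_subtractf sum_divide_distrib sum_distrib_right mult.assoc)
    qed
    have "(\<Sum>g\<in>G. y g * A g i) = 0" if "i < Suc n" for i
      using that x(2)[of i] h(2) unfolding eq by (cases "i = n") auto
    moreover have "\<exists>g\<in>G. y g \<noteq> 0"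
      using x(1) G' by (auto simp: y_def)
    ultimately show ?thesis by blast
  qed
qed

lemma sum_unit_mon:
  assumes "finite G"
  shows "(\<Sum>\<alpha>\<in>G. x \<alpha> * unit_mon \<alpha> \<beta>) = (if \<beta> \<in> G then x \<beta> else 0)"
  using assms by (simp add: unit_mon_def if_distrib cong: if_cong)

lemma Hb_linearD:
  "Hb_linear b F \<Longrightarrow> f \<in> Hb_space b \<Longrightarrow> g \<in> Hb_space b \<Longrightarrow>
    F (\<lambda>\<alpha>. c * f \<alpha> + g \<alpha>) = (\<lambda>\<alpha>. c * F f \<alpha> + F g \<alpha>)"
  by (auto simp: Hb_linear_def)

lemma Hb_linear_zero:
  assumes "Hb_linear b F"
  shows "F (\<lambda>_. 0) = (\<lambda>_. 0)"
proof -
  have "F (\<lambda>\<alpha>. -1 * (\<lambda>_. 0) \<alpha> + (\<lambda>_. 0) \<alpha>) = (\<lambda>\<alpha>. -1 * F (\<lambda>_. 0) \<alpha> + F (\<lambda>_. 0) \<alpha>)"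
    by (rule Hb_linearD[OF assms Hb_space_0 Hb_space_0])
  thus ?thesis by (simp add: fun_eq_iff)
qed

lemma Hb_linear_sum_unit_mon:
  assumes F: "Hb_linear b F" and "finite G"
  shows "F (\<lambda>\<beta>. \<Sum>\<alpha>\<in>G. x \<alpha> * unit_mon \<alpha> \<beta>) = (\<lambda>\<beta>. \<Sum>\<alpha>\<in>G. x \<alpha> * F (unit_mon \<alpha>) \<beta>)"
  using \<open>finite G\<close>
proof (induction G rule: finite_induct)
  case empty
  show ?case using Hb_linear_zero[OF F] by simp
next
  case (insert \<alpha> G)
  have "(\<lambda>\<beta>. \<Sum>\<alpha>\<in>G. x \<alpha> * unit_mon \<alpha> \<beta>) \<in> Hb_space b"
    by (rule Hb_space_finite_support[OF insert.hyps(1)]) (simp add: sum_unit_mon insert.hyps(1))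
  hence "F (\<lambda>\<beta>. x \<alpha> * unit_mon \<alpha> \<beta> + (\<Sum>\<alpha>\<in>G. x \<alpha> * unit_mon \<alpha> \<beta>))
      = (\<lambda>\<beta>. x \<alpha> * F (unit_mon \<alpha>) \<beta> + F (\<lambda>\<beta>. \<Sum>\<alpha>\<in>G. x \<alpha> * unit_mon \<alpha> \<beta>) \<beta>)"
    by (rule Hb_linearD[OF F unit_mon_Hb_space])
  thus ?case unfolding sum.insert[OF insert.hyps] insert.IH .
qed

lemma Hb_linear_0: "Hb_linear b (\<lambda>f \<alpha>. 0)"
  by (simp add: Hb_linear_def Hb_space_0)

lemma Hb_norm_0: "Hb_norm b (\<lambda>\<alpha>. 0) = 0"
  by (simp add: Hb_norm_eq sqpart_def[abs_def])

lemma Hb_bounded_0: "Hb_bounded b (\<lambda>f \<alpha>. 0)"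
  unfolding Hb_bounded_def by (intro exI[of _ 0]) (simp add: Hb_norm_0)

lemma Hb_rank_le_0: "Hb_rank_le b (\<lambda>f \<alpha>. 0) n"
  unfolding Hb_rank_le_def
  by (intro exI[of _ "\<lambda>_ _. 0"]) (auto simp: Hb_space_0)

text \<open>Boundedness of \<open>T\<close> makes the set under the infimum nonempty, with
  competitor \<open>F = 0\<close>; otherwise \<open>Inf\<close> would carry no information.\<close>

lemma sing_num_greatest:
  assumes T: "Hb_bounded b T"
    and le: "\<And>C F. C \<ge> 0 \<Longrightarrow> Hb_linear b F \<Longrightarrow> Hb_rank_le b F n \<Longrightarrow>
         (\<And>f. f \<in> Hb_space b \<Longrightarrow> Hb_norm b (\<lambda>\<alpha>. T f \<alpha> - F f \<alpha>) \<le> C * Hb_norm b f) \<Longrightarrow> r \<le> C"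
  shows "r \<le> sing_num b T n"
  unfolding sing_num_def
proof (rule cInf_greatest)
  obtain C where C: "\<And>f. f \<in> Hb_space b \<Longrightarrow> Hb_norm b (T f) \<le> C * Hb_norm b f"
    using T by (auto simp: Hb_bounded_def)
  have "Hb_norm b (\<lambda>\<alpha>. T f \<alpha> - 0) \<le> max 0 C * Hb_norm b f" if "f \<in> Hb_space b" for f
  proof -
    have "C * Hb_norm b f \<le> max 0 C * Hb_norm b f"
      using Hb_norm_nonneg[OF that] by (intro mult_right_mono) auto
    thus ?thesis using C[OF that] by simp
  qed
  thus "{C. C \<ge> 0 \<and> (\<exists>F. Hb_linear b F \<and> Hb_bounded b F \<and> Hb_rank_le b F n \<and>
      (\<forall>f\<in>Hb_space b. Hb_norm b (\<lambda>\<alpha>. T f \<alpha> - F f \<alpha>) \<le> C * Hb_norm b f))} \<noteq> {}"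
    using Hb_linear_0 Hb_bounded_0 Hb_rank_le_0
    by (intro ex_in_conv[THEN iffD1] exI[of _ "max 0 C"] CollectI conjI exI[of _ "\<lambda>f \<alpha>. 0"] ballI) auto
qed (use le in blast)

lemma sing_num_nonneg: "Hb_bounded b T \<Longrightarrow> sing_num b T n \<ge> 0"
  by (rule sing_num_greatest)

lemma sing_num_leI:
  assumes "C \<ge> 0" "Hb_linear b F" "Hb_bounded b F" "Hb_rank_le b F n"
    and "\<And>f. f \<in> Hb_space b \<Longrightarrow> Hb_norm b (\<lambda>\<alpha>. T f \<alpha> - F f \<alpha>) \<le> C * Hb_norm b f"
  shows "sing_num b T n \<le> C"
  unfolding sing_num_def
proof (rule cInf_lower)
  show "bdd_below {C. C \<ge> 0 \<and> (\<exists>F. Hb_linear b F \<and> Hb_bounded b F \<and> Hb_rank_le b F n \<and>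
      (\<forall>f\<in>Hb_space b. Hb_norm b (\<lambda>\<alpha>. T f \<alpha> - F f \<alpha>) \<le> C * Hb_norm b f))}"
    by (rule bdd_belowI[of _ 0]) auto
qed (use assms in auto)

lemma infinite_UNIV_multiindex: "infinite (UNIV :: ('n::finite \<Rightarrow> nat) set)"
proof -
  have "inj (\<lambda>n :: nat. (\<lambda>_ :: 'n. n))" by (auto simp: inj_def fun_eq_iff)
  thus ?thesis using range_inj_infinite infinite_super subset_UNIV by metis
qed

text \<open>With respect to the orthogonal basis of monomials, \<open>T\<close> is a weighted partial permutation;
  \<open>w \<alpha>\<close> bounds its weights in the normalised basis.\<close>

locale weighted_shift = weighted b D for b :: "nat \<Rightarrow> real" and D :: real +
  fixes T :: "'n::finite fps \<Rightarrow> 'n fps" and P :: "('n \<Rightarrow> nat) set"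
    and \<tau> :: "('n \<Rightarrow> nat) \<Rightarrow> complex" and \<phi> :: "('n \<Rightarrow> nat) \<Rightarrow> ('n \<Rightarrow> nat)" and w :: "('n \<Rightarrow> nat) \<Rightarrow> real"
  assumes T_eq: "\<And>f \<alpha>. f \<in> Hb_space b \<Longrightarrow> T f \<alpha> = (if \<alpha> \<in> P then \<tau> \<alpha> * f (\<phi> \<alpha>) else 0)"
    and inj: "inj_on \<phi> P"
    and deg: "\<And>\<alpha>. \<alpha> \<in> P \<Longrightarrow> mdeg (\<phi> \<alpha>) = mdeg \<alpha>"
    and w_nonneg: "\<And>\<alpha>. w \<alpha> \<ge> 0"
    and wt_le: "\<And>\<alpha>. \<alpha> \<in> P \<Longrightarrow> (cmod (\<tau> \<alpha>))\<^sup>2 * wt b \<alpha> \<le> (w \<alpha>)\<^sup>2 * wt b (\<phi> \<alpha>)"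
begin

section \<open>Upper bounds by truncating weighted shifts\<close>

text \<open>One estimate for three operators: \<open>Q = P\<close> is \<open>T\<close> itself,
  \<open>Q = P \<inter> F\<close> its finite rank truncation, and \<open>Q = P - F\<close> the
  remainder. Injectivity and preservation of degree keep the reindexed sum inside the degree k part
  of \<open>f\<close>.\<close>

lemma restricted:
  assumes Q: "Q \<subseteq> P" and C: "C \<ge> 0" "\<And>\<alpha>. \<alpha> \<in> Q \<Longrightarrow> w \<alpha> \<le> C" and f: "f \<in> Hb_space b"
  shows "(\<lambda>\<alpha>. if \<alpha> \<in> Q then \<tau> \<alpha> * f (\<phi> \<alpha>) else 0) \<in> Hb_space b" (is "?g \<in> _")
    and "Hb_norm b (\<lambda>\<alpha>. if \<alpha> \<in> Q then \<tau> \<alpha> * f (\<phi> \<alpha>) else 0) \<le> C * Hb_norm b f"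
proof -
  have "sqpart b ?g k \<le> C\<^sup>2 * sqpart b f k" for k
  proof -
    let ?A = "{\<alpha> :: 'n \<Rightarrow> nat. mdeg \<alpha> = k}"
    have "sqpart b ?g k = (\<Sum>\<alpha>\<in>?A \<inter> Q. wt b \<alpha> * (cmod (?g \<alpha>))\<^sup>2)"
      unfolding sqpart_def by (intro sum.mono_neutral_right) auto
    also have "\<dots> \<le> (\<Sum>\<alpha>\<in>?A \<inter> Q. C\<^sup>2 * (wt b (\<phi> \<alpha>) * (cmod (f (\<phi> \<alpha>)))\<^sup>2))"
    proof (rule sum_mono)
      fix \<alpha> assume "\<alpha> \<in> ?A \<inter> Q"
      hence \<alpha>: "\<alpha> \<in> Q" "\<alpha> \<in> P" using Q by auto
      have "(cmod (\<tau> \<alpha>))\<^sup>2 * wt b \<alpha> \<le> (w \<alpha>)\<^sup>2 * wt b (\<phi> \<alpha>)" by (rule wt_le[OF \<alpha>(2)])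
      also have "\<dots> \<le> C\<^sup>2 * wt b (\<phi> \<alpha>)"
        using C(2)[OF \<alpha>(1)] w_nonneg by (intro mult_right_mono power_mono wt_nonneg)
      finally have "(cmod (\<tau> \<alpha>))\<^sup>2 * wt b \<alpha> * (cmod (f (\<phi> \<alpha>)))\<^sup>2 \<le> C\<^sup>2 * wt b (\<phi> \<alpha>) * (cmod (f (\<phi> \<alpha>)))\<^sup>2"
        by (rule mult_right_mono) simp
      thus "wt b \<alpha> * (cmod (?g \<alpha>))\<^sup>2 \<le> C\<^sup>2 * (wt b (\<phi> \<alpha>) * (cmod (f (\<phi> \<alpha>)))\<^sup>2)"
        using \<alpha>(1) by (simp add: norm_mult power_mult_distrib mult_ac)
    qed
    also have "\<dots> = C\<^sup>2 * (\<Sum>\<beta>\<in>\<phi> ` (?A \<inter> Q). wt b \<beta> * (cmod (f \<beta>))\<^sup>2)"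
      using inj Q by (subst sum.reindex) (auto simp: sum_distrib_left intro: inj_on_subset)
    also have "\<dots> \<le> C\<^sup>2 * sqpart b f k"
      unfolding sqpart_def using Q deg by (intro mult_left_mono sum_mono2) (auto simp: wt_nonneg)
    finally show ?thesis .
  qed
  from Hb_space_bound[OF f C(1) this]
  show "?g \<in> Hb_space b" "Hb_norm b ?g \<le> C * Hb_norm b f" .
qed

lemma T_bounded:
  assumes "\<And>\<alpha>. w \<alpha> \<le> C"
  shows "Hb_linear b T" "Hb_bounded b T"
proof -
  have C: "C \<ge> 0" using assms[of undefined] w_nonneg[of undefined] by linarith
  have T: "T f = (\<lambda>\<alpha>. if \<alpha> \<in> P then \<tau> \<alpha> * f (\<phi> \<alpha>) else 0)" if "f \<in> Hb_space b" for f
    using T_eq[OF that] by auto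
  show "Hb_linear b T"
    unfolding Hb_linear_def
  proof (intro conjI ballI allI)
    fix f g :: "'n fps" and c :: complex
    assume f: "f \<in> Hb_space b" and g: "g \<in> Hb_space b"
    show "T f \<in> Hb_space b" unfolding T[OF f] by (rule restricted(1)[OF subset_refl C assms f])
    show "T (\<lambda>\<alpha>. c * f \<alpha> + g \<alpha>) = (\<lambda>\<alpha>. c * T f \<alpha> + T g \<alpha>)"
      unfolding T[OF f] T[OF g] T[OF Hb_space_lin[OF f g]] by (auto simp: algebra_simps)
  qed
  show "Hb_bounded b T"
    unfolding Hb_bounded_def using restricted(2)[OF subset_refl C assms] by (auto simp: T)
qed

text \<open>The competitor keeps only the output coefficients in \<open>F\<close>; its range lies in
  the span of \<open>card F\<close> monomials, and the remainder has weights at most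
  \<open>C\<close>.\<close>

lemma sing_num_le:
  assumes bdd: "\<And>\<alpha>. w \<alpha> \<le> U" and F: "finite F" and C: "C \<ge> 0" "\<And>\<alpha>. \<alpha> \<notin> F \<Longrightarrow> w \<alpha> \<le> C"
  shows "sing_num b T (card F) \<le> C"
proof -
  define R where "R f \<alpha> = (if \<alpha> \<in> P \<inter> F then \<tau> \<alpha> * f (\<phi> \<alpha>) else 0)" for f :: "'n fps" and \<alpha>
  have U: "U \<ge> 0" using bdd[of undefined] w_nonneg[of undefined] by linarith
  note R1 = restricted(1)[of "P \<inter> F", OF _ U bdd] and R2 = restricted(2)[of "P \<inter> F", OF _ U bdd]
  show ?thesis
  proof (rule sing_num_leI[OF C(1), where F = R])
    show "Hb_linear b R"
      unfolding Hb_linear_def R_def using R1 by (auto simp: fun_eq_iff algebra_simps)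
    show "Hb_bounded b R"
      unfolding Hb_bounded_def R_def using R2 by auto
    obtain e where e: "bij_betw e {..<card F} F"
      using ex_bij_betw_nat_finite[OF F] by (auto simp: atLeast0LessThan)
    have R_eq: "R f = (\<lambda>\<alpha>. \<Sum>i<card F. R f (e i) * unit_mon (e i) \<alpha>)" for f :: "'n fps"
    proof
      fix \<alpha>
      have "(\<Sum>i<card F. R f (e i) * unit_mon (e i) \<alpha>) = (\<Sum>\<beta>\<in>F. R f \<beta> * unit_mon \<beta> \<alpha>)"
        by (rule sum.reindex_bij_betw[OF e])
      also have "\<dots> = R f \<alpha>" unfolding sum_unit_mon[OF F] by (simp add: R_def)
      finally show "R f \<alpha> = (\<Sum>i<card F. R f (e i) * unit_mon (e i) \<alpha>)" ..
    qed
    have "\<exists>a. R f = (\<lambda>\<alpha>. \<Sum>i<card F. a i * unit_mon (e i) \<alpha>)" for f :: "'n fps"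
      by (rule exI[of _ "\<lambda>i. R f (e i)"], rule R_eq)
    thus "Hb_rank_le b R (card F)"
      unfolding Hb_rank_le_def
      by (intro exI[of _ "\<lambda>i. unit_mon (e i)"] conjI allI impI ballI unit_mon_Hb_space)
  next
    fix f :: "'n fps" assume f: "f \<in> Hb_space b"
    have "(\<lambda>\<alpha>. T f \<alpha> - R f \<alpha>) = (\<lambda>\<alpha>. if \<alpha> \<in> P - F then \<tau> \<alpha> * f (\<phi> \<alpha>) else 0)"
      by (auto simp: T_eq[OF f] R_def)
    thus "Hb_norm b (\<lambda>\<alpha>. T f \<alpha> - R f \<alpha>) \<le> C * Hb_norm b f"
      using restricted(2)[of "P - F" C f] C f by auto
  qed
qed

text \<open>Greedy choice in place of sorting: the next index has maximal weight outside the indices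
  already chosen, and this weight bounds the next singular number. The hypothesis \<open>max\<close>
  says that such a maximum is always attained.\<close>

lemma sum_sing_num_le:
  assumes max: "\<And>F. finite F \<Longrightarrow> \<exists>\<alpha>. \<alpha> \<notin> F \<and> (\<forall>\<beta>. \<beta> \<notin> F \<longrightarrow> w \<beta> \<le> w \<alpha>)" and p: "p \<ge> 0"
  shows "\<exists>F. finite F \<and> card F = N \<and> (\<Sum>n<N. sing_num b T n powr p) \<le> (\<Sum>\<alpha>\<in>F. w \<alpha> powr p)"
proof (induction N)
  case 0
  show ?case by (intro exI[of _ "{}"]) auto
next
  case (Suc N)
  then obtain F where F: "finite F" "card F = N" "(\<Sum>n<N. sing_num b T n powr p) \<le> (\<Sum>\<alpha>\<in>F. w \<alpha> powr p)"
    by auto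
  obtain \<gamma> where bdd: "\<And>\<beta>. w \<beta> \<le> w \<gamma>" using max[of "{}"] by auto
  obtain \<alpha> where \<alpha>: "\<alpha> \<notin> F" "\<And>\<beta>. \<beta> \<notin> F \<Longrightarrow> w \<beta> \<le> w \<alpha>" using max[OF F(1)] by auto
  have "sing_num b T N \<le> w \<alpha>"
    using sing_num_le[OF bdd F(1) w_nonneg \<alpha>(2)] F(2) by simp
  moreover have "sing_num b T N \<ge> 0"
    by (rule sing_num_nonneg[OF T_bounded(2)[OF bdd]])
  ultimately have "sing_num b T N powr p \<le> w \<alpha> powr p" using p by (intro powr_mono2)
  thus ?case using F \<alpha>(1) by (intro exI[of _ "insert \<alpha> F"]) simp
qed

text \<open>Every degree contains at least one multi-index, so the summability forces
  \<open>u\<close> to tend to 0. Hence maxima outside finite sets are attained and the greedy bound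
  applies.\<close>

lemma schatten_weighted_shift:
  assumes w: "\<And>\<alpha>. w \<alpha> = u (mdeg \<alpha>)" and p: "p \<ge> 1"
    and sm: "summable (\<lambda>k. real (card {\<alpha> :: 'n \<Rightarrow> nat. mdeg \<alpha> = k}) * u k powr p)"
  shows "schatten b p T"
proof -
  have "w (\<lambda>i. if i = undefined then k else 0) = u k" for k
    by (simp add: w mdeg_def)
  hence u_nonneg: "u k \<ge> 0" for k using w_nonneg by metis
  have deg_ex: "\<exists>\<alpha> :: 'n \<Rightarrow> nat. mdeg \<alpha> = k" for k
    by (intro exI[of _ "\<lambda>i. if i = undefined then k else 0"]) (simp add: mdeg_def)
  have small: "\<exists>K. \<forall>k\<ge>K. u k < r" if r: "r > 0" for r
  proof -
    have "eventually (\<lambda>k. real (card {\<alpha> :: 'n \<Rightarrow> nat. mdeg \<alpha> = k}) * u k powr p < r powr p) sequentially"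
      using summable_LIMSEQ_zero[OF sm] r by (intro order_tendstoD(2)) auto
    then obtain K where K: "\<And>k. k \<ge> K \<Longrightarrow> real (card {\<alpha> :: 'n \<Rightarrow> nat. mdeg \<alpha> = k}) * u k powr p < r powr p"
      unfolding eventually_sequentially by auto
    have "u k < r" if "k \<ge> K" for k
    proof (rule ccontr)
      assume "\<not> u k < r"
      hence "r powr p \<le> u k powr p" using r p by (intro powr_mono2) auto
      also have "\<dots> \<le> real (card {\<alpha> :: 'n \<Rightarrow> nat. mdeg \<alpha> = k}) * u k powr p"
      proof -
        have "card {\<alpha> :: 'n \<Rightarrow> nat. mdeg \<alpha> = k} > 0" using deg_ex[of k] by (simp add: card_gt_0_iff)
        hence "1 \<le> real (card {\<alpha> :: 'n \<Rightarrow> nat. mdeg \<alpha> = k})" by linarith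
        from mult_right_mono[OF this, of "u k powr p"] show ?thesis by simp
      qed
      finally show False using K[OF that] by simp
    qed
    thus ?thesis by blast
  qed
  have max: "\<exists>\<alpha>. \<alpha> \<notin> F \<and> (\<forall>\<beta>. \<beta> \<notin> F \<longrightarrow> w \<beta> \<le> w \<alpha>)" if F: "finite F" for F
  proof (cases "\<exists>\<beta>. \<beta> \<notin> F \<and> w \<beta> > 0")
    case False
    obtain \<alpha> where "\<alpha> \<notin> F" using ex_new_if_finite[OF infinite_UNIV_multiindex F] by auto
    thus ?thesis using False w_nonneg by (metis linorder_not_less order_trans)
  next
    case True
    then obtain \<gamma> where \<gamma>: "\<gamma> \<notin> F" "w \<gamma> > 0" by auto
    \<comment> \<open>Weights of at least \<open>w \<gamma>\<close> occur in finitely many degrees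
      only, so the maximum is taken over a finite set.\<close>
    define M where "M = {\<beta>. \<beta> \<notin> F \<and> w \<beta> \<ge> w \<gamma>}"
    obtain K where K: "\<And>k. k \<ge> K \<Longrightarrow> u k < w \<gamma>" using small[OF \<gamma>(2)] by auto
    have "M \<subseteq> (\<Union>k<K. {\<alpha>. mdeg \<alpha> = k})"
    proof
      fix \<alpha> assume "\<alpha> \<in> M"
      hence "\<not> u (mdeg \<alpha>) < w \<gamma>" by (simp add: M_def w)
      hence "mdeg \<alpha> < K" using K linorder_not_less by blast
      thus "\<alpha> \<in> (\<Union>k<K. {\<alpha>. mdeg \<alpha> = k})" by simp
    qed
    hence M: "finite M" by (rule finite_subset) simp
    have "M \<noteq> {}" using \<gamma> by (auto simp: M_def)
    hence "Max (w ` M) \<in> w ` M" using M by (intro Max_in) auto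
    then obtain \<alpha> where \<alpha>: "\<alpha> \<in> M" "w \<alpha> = Max (w ` M)" by auto
    have "w \<beta> \<le> w \<alpha>" if "\<beta> \<notin> F" for \<beta>
    proof (cases "\<beta> \<in> M")
      case True
      thus ?thesis using M by (simp add: \<alpha>(2))
    next
      case False
      thus ?thesis using that \<alpha>(1) by (auto simp: M_def)
    qed
    thus ?thesis using \<alpha>(1) by (auto simp: M_def)
  qed
  obtain \<gamma> where bdd: "\<And>\<beta>. w \<beta> \<le> w \<gamma>" using max[of "{}"] by auto
  have "summable (\<lambda>n. sing_num b T n powr p)"
  proof (rule summableI_nonneg_bounded)
    fix N
    obtain F where F: "finite F" "(\<Sum>n<N. sing_num b T n powr p) \<le> (\<Sum>\<alpha>\<in>F. w \<alpha> powr p)"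
      using sum_sing_num_le[OF max, of p N] p by auto
    note F(2)
    also have "(\<Sum>\<alpha>\<in>F. w \<alpha> powr p) = (\<Sum>k\<in>mdeg ` F. \<Sum>\<alpha>\<in>{\<alpha>\<in>F. mdeg \<alpha> = k}. w \<alpha> powr p)"
      using F(1) by (rule sum.image_gen)
    also have "\<dots> \<le> (\<Sum>k\<in>mdeg ` F. real (card {\<alpha> :: 'n \<Rightarrow> nat. mdeg \<alpha> = k}) * u k powr p)"
    proof (rule sum_mono)
      fix k
      have "(\<Sum>\<alpha>\<in>{\<alpha>\<in>F. mdeg \<alpha> = k}. w \<alpha> powr p) = real (card {\<alpha>\<in>F. mdeg \<alpha> = k}) * u k powr p"
        by (simp add: w)
      also have "\<dots> \<le> real (card {\<alpha> :: 'n \<Rightarrow> nat. mdeg \<alpha> = k}) * u k powr p"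
        by (intro mult_right_mono of_nat_mono card_mono) auto
      finally show "(\<Sum>\<alpha>\<in>{\<alpha>\<in>F. mdeg \<alpha> = k}. w \<alpha> powr p) \<le> real (card {\<alpha> :: 'n \<Rightarrow> nat. mdeg \<alpha> = k}) * u k powr p" .
    qed
    also have "\<dots> \<le> (\<Sum>k. real (card {\<alpha> :: 'n \<Rightarrow> nat. mdeg \<alpha> = k}) * u k powr p)"
      using F(1) sm by (intro sum_le_suminf) auto
    finally show "(\<Sum>n<N. sing_num b T n powr p) \<le> (\<Sum>k. real (card {\<alpha> :: 'n \<Rightarrow> nat. mdeg \<alpha> = k}) * u k powr p)" .
  qed simp
  thus ?thesis using T_bounded[OF bdd] by (simp add: schatten_def)
qed

end

section \<open>Lower bounds for diagonal operators\<close>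

context weighted
begin

text \<open>Dimension count: the span of the monomials in \<open>G\<close> has dimension above n, so
  it contains a nonzero \<open>f\<close> with \<open>F f = 0\<close>. There \<open>T - F\<close>
  coincides with \<open>T\<close>, which by orthogonality enlarges the norm of \<open>f\<close> by
  at least the factor \<open>r\<close>.\<close>

lemma sing_num_diag_ge:
  fixes T :: "'n::finite fps \<Rightarrow> 'n fps"
  assumes T_eq: "\<And>f \<alpha>. f \<in> Hb_space b \<Longrightarrow> T f \<alpha> = t \<alpha> * f \<alpha>" and T: "Hb_bounded b T"
    and G: "finite G" "n < card G" and r: "r \<ge> 0" "\<And>\<alpha>. \<alpha> \<in> G \<Longrightarrow> r \<le> cmod (t \<alpha>)"
  shows "r \<le> sing_num b T n"
proof (rule sing_num_greatest[OF T])
  fix C F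
  assume C: "C \<ge> 0" and F: "Hb_linear b F" "Hb_rank_le b F n"
    and le: "\<And>f. f \<in> Hb_space b \<Longrightarrow> Hb_norm b (\<lambda>\<alpha>. T f \<alpha> - F f \<alpha>) \<le> C * Hb_norm b f"
  obtain v where v: "\<And>f. f \<in> Hb_space b \<Longrightarrow> \<exists>a::nat \<Rightarrow> complex. F f = (\<lambda>\<alpha>. \<Sum>i<n. a i * v i \<alpha>)"
    using F(2) unfolding Hb_rank_le_def by auto
  have "\<forall>\<alpha>. \<exists>a::nat \<Rightarrow> complex. F (unit_mon \<alpha>) = (\<lambda>\<beta>. \<Sum>i<n. a i * v i \<beta>)"
    using v unit_mon_Hb_space by blast
  then obtain a :: "('n \<Rightarrow> nat) \<Rightarrow> nat \<Rightarrow> complex"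
    where a: "\<And>\<alpha>. F (unit_mon \<alpha>) = (\<lambda>\<beta>. \<Sum>i<n. a \<alpha> i * v i \<beta>)" by metis
  obtain x where x: "\<exists>\<alpha>\<in>G. x \<alpha> \<noteq> 0" "\<And>i. i < n \<Longrightarrow> (\<Sum>\<alpha>\<in>G. x \<alpha> * a \<alpha> i) = 0"
    using homogeneous_system_nontrivial[OF G, of a] by auto
  define f where "f = (\<lambda>\<beta>. \<Sum>\<alpha>\<in>G. x \<alpha> * unit_mon \<alpha> \<beta>)"
  have f_eq: "f \<beta> = (if \<beta> \<in> G then x \<beta> else 0)" for \<beta>
    unfolding f_def by (rule sum_unit_mon[OF G(1)])
  have f: "f \<in> Hb_space b"
    by (rule Hb_space_finite_support[OF G(1)]) (simp add: f_eq)
  have "F f \<beta> = 0" for \<beta>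
  proof -
    have "F f \<beta> = (\<Sum>\<alpha>\<in>G. \<Sum>i<n. x \<alpha> * a \<alpha> i * v i \<beta>)"
      unfolding f_def Hb_linear_sum_unit_mon[OF F(1) G(1)] a by (simp add: sum_distrib_left mult.assoc)
    also have "\<dots> = (\<Sum>i<n. (\<Sum>\<alpha>\<in>G. x \<alpha> * a \<alpha> i) * v i \<beta>)"
      unfolding sum_distrib_right by (rule sum.swap)
    also have "\<dots> = 0" using x(2) by simp
    finally show ?thesis .
  qed
  hence "(\<lambda>\<alpha>. T f \<alpha> - F f \<alpha>) = (\<lambda>\<alpha>. t \<alpha> * f \<alpha>)" by (simp add: T_eq[OF f])
  hence le': "Hb_norm b (\<lambda>\<alpha>. t \<alpha> * f \<alpha>) \<le> C * Hb_norm b f" using le[OF f] by simp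
  have g: "(\<lambda>\<alpha>. t \<alpha> * f \<alpha>) \<in> Hb_space b"
    by (rule Hb_space_finite_support[OF G(1)]) (simp add: f_eq)
  have sq: "r\<^sup>2 * sqpart b f k \<le> sqpart b (\<lambda>\<alpha>. t \<alpha> * f \<alpha>) k" for k
    unfolding sqpart_def sum_distrib_left
  proof (rule sum_mono)
    fix \<alpha>
    have "r\<^sup>2 * (cmod (f \<alpha>))\<^sup>2 \<le> (cmod (t \<alpha>))\<^sup>2 * (cmod (f \<alpha>))\<^sup>2"
      using r by (cases "\<alpha> \<in> G") (auto simp: f_eq intro!: mult_right_mono power_mono)
    from mult_left_mono[OF this wt_nonneg[of b \<alpha>]]
    show "r\<^sup>2 * (wt b \<alpha> * (cmod (f \<alpha>))\<^sup>2) \<le> wt b \<alpha> * (cmod (t \<alpha> * f \<alpha>))\<^sup>2"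
      by (simp add: norm_mult power_mult_distrib mult_ac)
  qed
  have sf: "summable (sqpart b f)" and sg: "summable (sqpart b (\<lambda>\<alpha>. t \<alpha> * f \<alpha>))"
    using f g by (simp_all add: Hb_space_iff)
  have "r\<^sup>2 * suminf (sqpart b f) = (\<Sum>k. r\<^sup>2 * sqpart b f k)"
    by (rule suminf_mult[symmetric, OF sf])
  also have "\<dots> \<le> suminf (sqpart b (\<lambda>\<alpha>. t \<alpha> * f \<alpha>))"
    by (rule suminf_le[OF sq summable_mult[OF sf] sg])
  finally have "sqrt (r\<^sup>2 * suminf (sqpart b f)) \<le> Hb_norm b (\<lambda>\<alpha>. t \<alpha> * f \<alpha>)"
    unfolding Hb_norm_eq by simp
  hence "r * Hb_norm b f \<le> C * Hb_norm b f"
    using le' r(1) by (simp add: real_sqrt_mult Hb_norm_eq)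
  moreover have "Hb_norm b f > 0"
  proof -
    obtain \<alpha> where \<alpha>: "\<alpha> \<in> G" "x \<alpha> \<noteq> 0" using x(1) by auto
    have "0 < wt b \<alpha> * (cmod (f \<alpha>))\<^sup>2" using \<alpha> wt_pos[of \<alpha>] by (simp add: f_eq)
    also have "\<dots> \<le> sqpart b f (mdeg \<alpha>)"
      unfolding sqpart_def by (rule member_le_sum) (auto simp: wt_nonneg)
    finally have "0 < suminf (sqpart b f)"
      using sqpart_nonneg by (intro suminf_pos2[OF sf]) 
    thus ?thesis by (simp add: Hb_norm_eq)
  qed
  ultimately show "r \<le> C" by simp
qed

text \<open>Reverse of the greedy bound: the smallest of N+1 entries is at most the singular number
  with index N, since all N+1 entries are at least as large; it is removed and the induction
  continues.\<close>

lemma sum_diag_le: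
  fixes T :: "'n::finite fps \<Rightarrow> 'n fps"
  assumes T_eq: "\<And>f \<alpha>. f \<in> Hb_space b \<Longrightarrow> T f \<alpha> = t \<alpha> * f \<alpha>" and T: "Hb_bounded b T"
    and G: "finite G" "card G = N" and p: "p \<ge> 0"
  shows "(\<Sum>\<alpha>\<in>G. cmod (t \<alpha>) powr p) \<le> (\<Sum>n<N. sing_num b T n powr p)"
  using G
proof (induction N arbitrary: G)
  case 0
  thus ?case by simp
next
  case (Suc N)
  let ?m = "\<lambda>\<alpha>. cmod (t \<alpha>)"
  have "G \<noteq> {}" using Suc.prems by auto
  hence "Min (?m ` G) \<in> ?m ` G" using Suc.prems by (intro Min_in) auto
  then obtain \<alpha> where \<alpha>: "\<alpha> \<in> G" "?m \<alpha> = Min (?m ` G)" by auto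
  have "?m \<alpha> \<le> ?m \<beta>" if "\<beta> \<in> G" for \<beta>
    unfolding \<alpha>(2) using that Suc.prems by (intro Min_le) auto
  hence "?m \<alpha> \<le> sing_num b T N"
    using Suc.prems by (intro sing_num_diag_ge[OF T_eq T, of G]) auto
  hence "?m \<alpha> powr p \<le> sing_num b T N powr p" using p by (intro powr_mono2) auto
  moreover have "(\<Sum>\<alpha>\<in>G - {\<alpha>}. ?m \<alpha> powr p) \<le> (\<Sum>n<N. sing_num b T n powr p)"
    using Suc.prems \<alpha>(1) by (intro Suc.IH) auto
  moreover have "(\<Sum>\<alpha>\<in>G. ?m \<alpha> powr p) = ?m \<alpha> powr p + (\<Sum>\<alpha>\<in>G - {\<alpha>}. ?m \<alpha> powr p)"
    using Suc.prems(1) \<alpha>(1) by (rule sum.remove)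
  ultimately show ?case by simp
qed

lemma schatten_diag_summable:
  fixes T :: "'n::finite fps \<Rightarrow> 'n fps"
  assumes T_eq: "\<And>f \<alpha>. f \<in> Hb_space b \<Longrightarrow> T f \<alpha> = t \<alpha> * f \<alpha>" and T: "schatten b p T" and p: "p \<ge> 0"
  shows "summable (\<lambda>k. \<Sum>\<alpha> | mdeg \<alpha> = k. cmod (t \<alpha>) powr p)"
proof (rule summableI_nonneg_bounded)
  fix K
  define G where "G = (\<Union>k<K. {\<alpha> :: 'n \<Rightarrow> nat. mdeg \<alpha> = k})"
  have G: "finite G" unfolding G_def by auto
  have bT: "Hb_bounded b T" and sT: "summable (\<lambda>n. sing_num b T n powr p)"
    using T by (auto simp: schatten_def)
  have "(\<Sum>k<K. \<Sum>\<alpha> | mdeg \<alpha> = k. cmod (t \<alpha>) powr p) = (\<Sum>\<alpha>\<in>G. cmod (t \<alpha>) powr p)"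
    unfolding G_def by (subst sum.UNION_disjoint) auto
  also have "\<dots> \<le> (\<Sum>n<card G. sing_num b T n powr p)"
    by (rule sum_diag_le[OF T_eq bT G refl p])
  also have "\<dots> \<le> (\<Sum>n. sing_num b T n powr p)"
    by (rule sum_le_suminf[OF sT]) auto
  finally show "(\<Sum>k<K. \<Sum>\<alpha> | mdeg \<alpha> = k. cmod (t \<alpha>) powr p) \<le> (\<Sum>n. sing_num b T n powr p)" .
qed (auto intro: sum_nonneg)

end

section \<open>Sums over multi-indices of a given degree\<close>

lemma powr_add_le:
  fixes x y p :: real
  assumes "x \<ge> 0" "y \<ge> 0" "p \<ge> 0"
  shows "(x + y) powr p \<le> 2 powr p * (x powr p + y powr p)"
proof -
  have "(x + y) powr p \<le> (2 * max x y) powr p"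
    using assms by (intro powr_mono2) auto
  also have "\<dots> = 2 powr p * max x y powr p"
    using assms by (simp add: powr_mult)
  also have "max x y powr p \<le> x powr p + y powr p"
    by (simp add: max_def)
  finally show ?thesis by simp
qed

text \<open>One coordinate is determined by the degree and the others, each of which is at most
  k.\<close>

lemma card_mdeg_le: "card {\<alpha> :: 'n::finite \<Rightarrow> nat. mdeg \<alpha> = k} \<le> (k + 1) ^ (CARD('n) - 1)"
proof -
  define i :: 'n where "i = undefined"
  let ?A = "{\<alpha> :: 'n \<Rightarrow> nat. mdeg \<alpha> = k}" and ?I = "UNIV - {i}"
  have split: "mdeg \<alpha> = \<alpha> i + (\<Sum>k\<in>?I. \<alpha> k)" for \<alpha>
    unfolding mdeg_def by (rule sum.remove) auto
  have "inj_on (\<lambda>\<alpha>. restrict \<alpha> ?I) ?A"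
  proof (rule inj_onI)
    fix \<alpha> \<beta> assume ab: "\<alpha> \<in> ?A" "\<beta> \<in> ?A" "restrict \<alpha> ?I = restrict \<beta> ?I"
    have eq: "\<alpha> k = \<beta> k" if "k \<noteq> i" for k
      using fun_cong[OF ab(3), of k] that by simp
    hence "(\<Sum>k\<in>?I. \<alpha> k) = (\<Sum>k\<in>?I. \<beta> k)" by (intro sum.cong) auto
    hence "\<alpha> i = \<beta> i" using ab split[of \<alpha>] split[of \<beta>] by simp
    thus "\<alpha> = \<beta>" using eq by (metis ext)
  qed
  hence "card ?A = card ((\<lambda>\<alpha>. restrict \<alpha> ?I) ` ?A)" by (rule card_image[symmetric])
  also have "\<dots> \<le> card (PiE ?I (\<lambda>_. {..k}))"
  proof (rule card_mono)
    show "(\<lambda>\<alpha>. restrict \<alpha> ?I) ` ?A \<subseteq> PiE ?I (\<lambda>_. {..k})"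
    proof (rule image_subsetI)
      fix \<alpha> assume \<alpha>: "\<alpha> \<in> ?A"
      have "\<alpha> x \<le> mdeg \<alpha>" for x unfolding mdeg_def by (rule member_le_sum) auto
      thus "restrict \<alpha> ?I \<in> PiE ?I (\<lambda>_. {..k})"
        using \<alpha> by (simp add: restrict_PiE_iff)
    qed
  qed (auto intro: finite_PiE)
  also have "\<dots> = (k + 1) ^ (CARD('n) - 1)"
    by (simp add: card_PiE card_Diff_singleton)
  finally show ?thesis .
qed

text \<open>All coordinates but one range freely over {0..k div m}; their sum stays below k, and the
  remaining coordinate absorbs the rest.\<close>

lemma card_mdeg_ge: "(real (k + 1) / real CARD('n)) ^ (CARD('n) - 1) \<le> real (card {\<alpha> :: 'n::finite \<Rightarrow> nat. mdeg \<alpha> = k})"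
proof -
  define i :: 'n where "i = undefined"
  define q where "q = k div CARD('n)"
  let ?A = "{\<alpha> :: 'n \<Rightarrow> nat. mdeg \<alpha> = k}" and ?I = "UNIV - {i}"
  define E where "E \<beta> = (\<lambda>x. if x = i then k - (\<Sum>k\<in>?I. \<beta> k) else \<beta> x)" for \<beta> :: "'n \<Rightarrow> nat"
  have split: "mdeg \<alpha> = \<alpha> i + (\<Sum>k\<in>?I. \<alpha> k)" for \<alpha>
    unfolding mdeg_def by (rule sum.remove) auto
  have "card (PiE ?I (\<lambda>_. {..q})) \<le> card ?A"
  proof (rule card_inj_on_le)
    show "inj_on E (PiE ?I (\<lambda>_. {..q}))"
    proof (rule inj_onI)
      fix \<alpha> \<beta> assume ab: "\<alpha> \<in> PiE ?I (\<lambda>_. {..q})" "\<beta> \<in> PiE ?I (\<lambda>_. {..q})" "E \<alpha> = E \<beta>"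
      show "\<alpha> = \<beta>"
      proof (rule PiE_ext[OF ab(1,2)])
        fix x assume "x \<in> ?I"
        thus "\<alpha> x = \<beta> x" using fun_cong[OF ab(3), of x] by (simp add: E_def)
      qed
    qed
    show "E ` PiE ?I (\<lambda>_. {..q}) \<subseteq> ?A"
    proof safe
      fix \<beta> assume \<beta>: "\<beta> \<in> PiE ?I (\<lambda>_. {..q})"
      have "(\<Sum>k\<in>?I. \<beta> k) \<le> (\<Sum>k\<in>?I. q)" using \<beta> by (intro sum_mono) auto
      also have "\<dots> \<le> CARD('n) * q" by (simp add: card_Diff_singleton)
      also have "\<dots> \<le> k" by (simp add: q_def)
      finally have le: "(\<Sum>k\<in>?I. \<beta> k) \<le> k" .
      have "(\<Sum>k\<in>?I. E \<beta> k) = (\<Sum>k\<in>?I. \<beta> k)" by (intro sum.cong) (auto simp: E_def)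
      thus "mdeg (E \<beta>) = k" unfolding split[of "E \<beta>"] using le by (simp add: E_def)
    qed
  qed simp
  hence "(q + 1) ^ (CARD('n) - 1) \<le> card ?A"
    by (simp add: card_PiE card_Diff_singleton)
  hence "real ((q + 1) ^ (CARD('n) - 1)) \<le> real (card ?A)" by (rule of_nat_mono)
  moreover have "(real (k + 1) / real CARD('n)) ^ (CARD('n) - 1) \<le> real ((q + 1) ^ (CARD('n) - 1))"
  proof -
    have "k < (q + 1) * CARD('n)"
    proof -
      have "k mod CARD('n) < CARD('n)" by simp
      hence "k < k div CARD('n) * CARD('n) + CARD('n)"
        using div_mult_mod_eq[of k "CARD('n)"] by linarith
      thus ?thesis by (simp add: q_def add.commute)
    qed
    hence "k + 1 \<le> (q + 1) * CARD('n)" by simp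
    hence "real (k + 1) \<le> real ((q + 1) * CARD('n))" by (rule of_nat_mono)
    hence "real (k + 1) / real CARD('n) \<le> real (q + 1)"
      by (simp only: of_nat_mult pos_divide_le_eq of_nat_0_less_iff zero_less_card_finite)
    thus ?thesis unfolding of_nat_power by (intro power_mono) auto
  qed
  ultimately show ?thesis by linarith
qed

text \<open>Adding \<open>h\<close> to the coordinate \<open>j\<close> or to the coordinate \<open>l\<close> of \<open>\<beta>\<close> gives two multi-indices of
  degree \<open>k\<close> at which the affine function differs by \<open>c * h\<close>.\<close>

lemma sum_affine_ge:
  fixes c d p :: real and j l :: "'n::finite"
  assumes jl: "j \<noteq> l" and p: "p \<ge> 0" and h: "h \<le> k"
  shows "real (card {\<beta> :: 'n \<Rightarrow> nat. mdeg \<beta> = k - h}) * (\<bar>c\<bar> * real h) powr p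
       \<le> 2 powr p * 2 * (\<Sum>\<alpha> | mdeg (\<alpha> :: 'n \<Rightarrow> nat) = k. \<bar>c * real (\<alpha> j) + d\<bar> powr p)"
proof -
  let ?B = "{\<beta> :: 'n \<Rightarrow> nat. mdeg \<beta> = k - h}" and ?A = "{\<alpha> :: 'n \<Rightarrow> nat. mdeg \<alpha> = k}"
  define v where "v \<alpha> = \<bar>c * real (\<alpha> j) + d\<bar>" for \<alpha> :: "'n \<Rightarrow> nat"
  define R where "R i \<beta> = \<beta>(i := \<beta> i + h)" for i and \<beta> :: "'n \<Rightarrow> nat"
  have mdeg_R: "mdeg (R i \<beta>) = mdeg \<beta> + h" for i \<beta>
  proof -
    have split: "mdeg \<alpha> = \<alpha> i + (\<Sum>k\<in>UNIV - {i}. \<alpha> k)" for \<alpha>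
      unfolding mdeg_def by (rule sum.remove) auto
    have "(\<Sum>k\<in>UNIV - {i}. R i \<beta> k) = (\<Sum>k\<in>UNIV - {i}. \<beta> k)"
      by (intro sum.cong) (auto simp: R_def)
    thus ?thesis unfolding split[of "R i \<beta>"] split[of \<beta>] by (simp add: R_def)
  qed
  have sum_R: "(\<Sum>\<beta>\<in>?B. v (R i \<beta>) powr p) \<le> (\<Sum>\<alpha>\<in>?A. v \<alpha> powr p)" for i
  proof -
    have "inj (R i)"
    proof (rule injI)
      fix \<alpha> \<beta> assume eq: "R i \<alpha> = R i \<beta>"
      show "\<alpha> = \<beta>"
      proof
        fix x show "\<alpha> x = \<beta> x" using fun_cong[OF eq, of x] by (cases "x = i") (auto simp: R_def)
      qed
    qed
    hence "(\<Sum>\<beta>\<in>?B. v (R i \<beta>) powr p) = (\<Sum>\<alpha>\<in>R i ` ?B. v \<alpha> powr p)"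
      by (subst sum.reindex) (auto intro: inj_on_subset)
    also have "\<dots> \<le> (\<Sum>\<alpha>\<in>?A. v \<alpha> powr p)"
      using h by (intro sum_mono2) (auto simp: mdeg_R)
    finally show ?thesis .
  qed
  have "real (card ?B) * (\<bar>c\<bar> * real h) powr p = (\<Sum>\<beta>\<in>?B. (\<bar>c\<bar> * real h) powr p)" by simp
  also have "\<dots> \<le> (\<Sum>\<beta>\<in>?B. 2 powr p * (v (R j \<beta>) powr p + v (R l \<beta>) powr p))"
  proof (rule sum_mono)
    fix \<beta>
    have "\<bar>c\<bar> * real h = \<bar>(c * real (R j \<beta> j) + d) - (c * real (R l \<beta> j) + d)\<bar>"
      using jl by (simp add: R_def algebra_simps abs_mult)
    also have "\<dots> \<le> v (R j \<beta>) + v (R l \<beta>)"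
      unfolding v_def by (rule abs_triangle_ineq4)
    finally have "(\<bar>c\<bar> * real h) powr p \<le> (v (R j \<beta>) + v (R l \<beta>)) powr p"
      using p by (intro powr_mono2) auto
    also have "\<dots> \<le> 2 powr p * (v (R j \<beta>) powr p + v (R l \<beta>) powr p)"
      using p by (intro powr_add_le) (auto simp: v_def)
    finally show "(\<bar>c\<bar> * real h) powr p \<le> 2 powr p * (v (R j \<beta>) powr p + v (R l \<beta>) powr p)" .
  qed
  also have "\<dots> = 2 powr p * ((\<Sum>\<beta>\<in>?B. v (R j \<beta>) powr p) + (\<Sum>\<beta>\<in>?B. v (R l \<beta>) powr p))"
    by (simp only: sum_distrib_left[symmetric] sum.distrib)
  also have "\<dots> \<le> 2 powr p * ((\<Sum>\<alpha>\<in>?A. v \<alpha> powr p) + (\<Sum>\<alpha>\<in>?A. v \<alpha> powr p))"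
    by (intro mult_left_mono add_mono sum_R) auto
  finally show ?thesis by (simp add: v_def)
qed

text \<open>One factor \<open>2 powr p\<close> comes from k <= 2h, the factor
  \<open>2 powr p * 2\<close> from \<open>sum_affine_ge\<close>, and the power of 2m from counting
  multi-indices of degree k div 2.\<close>

lemma slope_le_sum_affine:
  fixes c d p :: real and j l :: "'n::finite"
  assumes jl: "j \<noteq> l" and p: "p \<ge> 0"
  shows "real (k + 1) ^ (CARD('n) - 1) * (\<bar>c\<bar> * real k) powr p
       \<le> 2 powr p * 2 powr p * 2 * (2 * real CARD('n)) ^ (CARD('n) - 1)
           * (\<Sum>\<alpha> | mdeg (\<alpha> :: 'n \<Rightarrow> nat) = k. \<bar>c * real (\<alpha> j) + d\<bar> powr p)"
proof -
  define m where "m = CARD('n)"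
  have m: "m > 0" by (simp add: m_def)
  define V where "V = (\<Sum>\<alpha> | mdeg (\<alpha> :: 'n \<Rightarrow> nat) = k. \<bar>c * real (\<alpha> j) + d\<bar> powr p)"
  \<comment> \<open>Halving the degree balances two needs: \<open>h\<close> must be comparable to
    \<open>k\<close> for a large difference of weights, and \<open>k - h\<close> must be comparable
    to \<open>k\<close> so that about k^(m-1) base indices remain.\<close>
  define h where "h = k - k div 2"
  define N where "N = real (card {\<beta> :: 'n \<Rightarrow> nat. mdeg \<beta> = k - h})"
  have h: "h \<le> k" "k - h = k div 2" by (auto simp: h_def)
  have "real k \<le> 2 * real h" unfolding h_def by linarith
  have "(\<bar>c\<bar> * real k) powr p \<le> (2 * (\<bar>c\<bar> * real h)) powr p"
  proof (rule powr_mono2)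
    have "\<bar>c\<bar> * real k \<le> \<bar>c\<bar> * (2 * real h)"
      using \<open>real k \<le> 2 * real h\<close> by (rule mult_left_mono) simp
    thus "\<bar>c\<bar> * real k \<le> 2 * (\<bar>c\<bar> * real h)" by simp
  qed (use p in auto)
  also have "\<dots> = 2 powr p * (\<bar>c\<bar> * real h) powr p" by (simp add: powr_mult)
  finally have 1: "(\<bar>c\<bar> * real k) powr p \<le> 2 powr p * (\<bar>c\<bar> * real h) powr p" .
  have "(real (k + 1) / (2 * real m)) ^ (m - 1) \<le> (real (k div 2 + 1) / real m) ^ (m - 1)"
  proof (rule power_mono)
    have "k + 1 \<le> 2 * (k div 2 + 1)" by presburger
    hence "real (k + 1) \<le> real (2 * (k div 2 + 1))" by (rule of_nat_mono)
    hence "real (k + 1) \<le> 2 * real (k div 2 + 1)" by simp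
    hence "real (k + 1) / (2 * real m) \<le> (2 * real (k div 2 + 1)) / (2 * real m)"
      by (rule divide_right_mono) simp
    also have "\<dots> = real (k div 2 + 1) / real m"
      by (rule mult_divide_mult_cancel_left) simp
    finally show "real (k + 1) / (2 * real m) \<le> real (k div 2 + 1) / real m" .
  qed simp
  also have "\<dots> \<le> N"
    using card_mdeg_ge[of "k div 2", where 'n = 'n] by (simp add: N_def h m_def)
  finally have 2: "real (k + 1) ^ (m - 1) \<le> (2 * real m) ^ (m - 1) * N"
    using m by (simp add: power_divide divide_le_eq mult.commute)
  have "real (k + 1) ^ (m - 1) * (\<bar>c\<bar> * real k) powr p
      \<le> ((2 * real m) ^ (m - 1) * N) * (2 powr p * (\<bar>c\<bar> * real h) powr p)"
    by (intro mult_mono 1 2) (auto simp: N_def)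
  also have "\<dots> = 2 powr p * (2 * real m) ^ (m - 1) * (N * (\<bar>c\<bar> * real h) powr p)"
    by (simp add: mult_ac)
  also have "\<dots> \<le> 2 powr p * (2 * real m) ^ (m - 1) * (2 powr p * 2 * V)"
    unfolding N_def V_def by (intro mult_left_mono sum_affine_ge[OF jl p h(1)]) auto
  finally show ?thesis by (simp add: V_def m_def mult_ac)
qed

text \<open>Since \<alpha>_j <= k, the triangle inequality bounds \<open>d\<close> by the affine
  value plus |c| k at every multi-index of degree k; the slope term is already controlled.\<close>

lemma intercept_le_sum_affine:
  fixes c d p :: real and j :: "'n::finite"
  assumes p: "p \<ge> 0" and d: "d \<ge> 0"
  shows "real (k + 1) ^ (CARD('n) - 1) * d powr p
       \<le> real CARD('n) ^ (CARD('n) - 1) * 2 powr p *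
          ((\<Sum>\<alpha> | mdeg (\<alpha> :: 'n \<Rightarrow> nat) = k. \<bar>c * real (\<alpha> j) + d\<bar> powr p)
            + real (k + 1) ^ (CARD('n) - 1) * (\<bar>c\<bar> * real k) powr p)"
proof -
  define m where "m = CARD('n)"
  have m: "m > 0" by (simp add: m_def)
  let ?A = "{\<alpha> :: 'n \<Rightarrow> nat. mdeg \<alpha> = k}"
  define v where "v \<alpha> = \<bar>c * real (\<alpha> j) + d\<bar>" for \<alpha> :: "'n \<Rightarrow> nat"
  have "real (card ?A) * d powr p = (\<Sum>\<alpha>\<in>?A. d powr p)" by simp
  also have "\<dots> \<le> (\<Sum>\<alpha>\<in>?A. 2 powr p * (v \<alpha> powr p + (\<bar>c\<bar> * real k) powr p))"
  proof (rule sum_mono)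
    fix \<alpha> assume "\<alpha> \<in> ?A"
    have "\<alpha> j \<le> mdeg \<alpha>" unfolding mdeg_def by (rule member_le_sum) auto
    hence "real (\<alpha> j) \<le> real k" using \<open>\<alpha> \<in> ?A\<close> by simp
    hence "\<bar>c * real (\<alpha> j)\<bar> \<le> \<bar>c\<bar> * real k" by (simp add: abs_mult mult_left_mono)
    hence "d \<le> v \<alpha> + \<bar>c\<bar> * real k" unfolding v_def by linarith
    hence "d powr p \<le> (v \<alpha> + \<bar>c\<bar> * real k) powr p" using d p by (intro powr_mono2)
    also have "\<dots> \<le> 2 powr p * (v \<alpha> powr p + (\<bar>c\<bar> * real k) powr p)"
      using p by (intro powr_add_le) (auto simp: v_def)
    finally show "d powr p \<le> 2 powr p * (v \<alpha> powr p + (\<bar>c\<bar> * real k) powr p)" .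
  qed
  also have "\<dots> = 2 powr p * ((\<Sum>\<alpha>\<in>?A. v \<alpha> powr p) + real (card ?A) * (\<bar>c\<bar> * real k) powr p)"
    by (simp add: sum_distrib_left[symmetric] sum.distrib)
  also have "\<dots> \<le> 2 powr p * ((\<Sum>\<alpha>\<in>?A. v \<alpha> powr p) + real (k + 1) ^ (m - 1) * (\<bar>c\<bar> * real k) powr p)"
  proof -
    have "real (card ?A) \<le> real ((k + 1) ^ (m - 1))" unfolding m_def by (rule of_nat_mono[OF card_mdeg_le])
    thus ?thesis by (intro mult_left_mono add_left_mono mult_right_mono) auto
  qed
  finally have 1: "real (card ?A) * d powr p
      \<le> 2 powr p * ((\<Sum>\<alpha>\<in>?A. v \<alpha> powr p) + real (k + 1) ^ (m - 1) * (\<bar>c\<bar> * real k) powr p)" .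
  have "real (k + 1) ^ (m - 1) \<le> real m ^ (m - 1) * real (card ?A)"
    using card_mdeg_ge[of k, where 'n = 'n] m by (simp add: m_def power_divide divide_le_eq mult.commute)
  hence "real (k + 1) ^ (m - 1) * d powr p \<le> real m ^ (m - 1) * (real (card ?A) * d powr p)"
    unfolding mult.assoc[symmetric] by (intro mult_right_mono) auto
  also have "\<dots> \<le> real m ^ (m - 1) * (2 powr p * ((\<Sum>\<alpha>\<in>?A. v \<alpha> powr p) + real (k + 1) ^ (m - 1) * (\<bar>c\<bar> * real k) powr p))"
    by (intro mult_left_mono 1) auto
  finally show ?thesis unfolding v_def m_def by (simp only: mult.assoc)
qed

section \<open>Schatten membership and the two series\<close>

context weighted
begin

lemma dd_nonneg: "dd TYPE('n::finite) k \<ge> 0"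
  by (simp add: dd_def)

text \<open>With m at least 2 the denominator k + m - 1 is nonzero even at k = 0.\<close>

lemma cc_dd:
  assumes "CARD('n::finite) \<ge> 2"
  shows "cc TYPE('n) k * (real k + real CARD('n) - 1) + dd TYPE('n) k = (delta b k)\<^sup>2 - (delta b (k - 1))\<^sup>2"
proof -
  define s where "s = real k + real CARD('n)"
  have "s \<ge> 2" using assms unfolding s_def by linarith
  hence "((delta b k)\<^sup>2 / s - (delta b (k - 1))\<^sup>2 / (s - 1)) * (s - 1) + (delta b k)\<^sup>2 / s
       = (delta b k)\<^sup>2 - (delta b (k - 1))\<^sup>2"
    by (simp add: field_simps)
  thus ?thesis by (simp add: cc_def dd_def s_def)
qed

text \<open>One majorant \<open>u\<close>, depending on the degree only, dominates the normalised
  weights of all commutators, so the diagonal and off-diagonal cases need the same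
  summability.\<close>

lemma schatten_comm:
  fixes j l :: "'n::finite"
  assumes p: "p \<ge> 1"
    and sm: "summable (\<lambda>k. real (card {\<alpha> :: 'n \<Rightarrow> nat. mdeg \<alpha> = k}) *
               (\<bar>cc TYPE('n) k\<bar> * (real k + 1) + dd TYPE('n) k) powr p)"
  shows "schatten b p (comm (Hb_adj b (Mz j)) (Mz l))"
proof -
  define u where "u k = \<bar>cc TYPE('n) k\<bar> * (real k + 1) + dd TYPE('n) k" for k
  have u_nonneg: "u k \<ge> 0" for k unfolding u_def by (intro add_nonneg_nonneg dd_nonneg) auto
  show ?thesis
  proof (cases "j = l")
    case True
    interpret weighted_shift b D "comm (Hb_adj b (Mz j)) (Mz l)" UNIV
      "\<lambda>\<alpha>. of_real (cc TYPE('n) (mdeg \<alpha>) * real (\<alpha> j) + dd TYPE('n) (mdeg \<alpha>))" "\<lambda>\<alpha>. \<alpha>" "\<lambda>\<alpha>. u (mdeg \<alpha>)"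
    proof unfold_locales
      fix \<alpha> :: "'n \<Rightarrow> nat"
      let ?t = "cc TYPE('n) (mdeg \<alpha>) * real (\<alpha> j) + dd TYPE('n) (mdeg \<alpha>)"
      have "\<bar>cc TYPE('n) (mdeg \<alpha>)\<bar> * real (\<alpha> j) \<le> \<bar>cc TYPE('n) (mdeg \<alpha>)\<bar> * (real (mdeg \<alpha>) + 1)"
        using le_mdeg[of \<alpha> j] by (intro mult_left_mono) auto
      hence "\<bar>?t\<bar> \<le> u (mdeg \<alpha>)"
        unfolding u_def using dd_nonneg[of "mdeg \<alpha>", where 'n = 'n]
          abs_triangle_ineq[of "cc TYPE('n) (mdeg \<alpha>) * real (\<alpha> j)" "dd TYPE('n) (mdeg \<alpha>)"]
        by (simp add: abs_mult)
      hence "?t\<^sup>2 \<le> (u (mdeg \<alpha>))\<^sup>2" using u_nonneg by (simp add: abs_le_square_iff[symmetric])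
      thus "(cmod (of_real ?t))\<^sup>2 * wt b \<alpha> \<le> (u (mdeg \<alpha>))\<^sup>2 * wt b \<alpha>"
        unfolding norm_of_real power2_abs by (rule mult_right_mono[OF _ wt_nonneg])
    qed (use True u_nonneg in \<open>auto simp: comm_diag\<close>)
    show ?thesis by (rule schatten_weighted_shift[of u, OF refl p]) (use sm in \<open>simp add: u_def\<close>)
  next
    case False
    interpret weighted_shift b D "comm (Hb_adj b (Mz j)) (Mz l)" "{\<alpha>. \<alpha> l \<noteq> 0}"
      "\<lambda>\<alpha>. of_real (cc TYPE('n) (mdeg \<alpha>) * (real (\<alpha> j) + 1))" "shft j l" "\<lambda>\<alpha>. u (mdeg \<alpha>)"
    proof unfold_locales
      fix \<alpha> :: "'n \<Rightarrow> nat" assume "\<alpha> \<in> {\<alpha>. \<alpha> l \<noteq> 0}"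
      hence \<alpha>: "\<alpha> l \<noteq> 0" by simp
      show "mdeg (shft j l \<alpha>) = mdeg \<alpha>" by (rule mdeg_shft[of \<alpha> l, OF \<alpha>])
      let ?c = "cc TYPE('n) (mdeg \<alpha>)"
      have "(cmod (of_real (?c * (real (\<alpha> j) + 1))))\<^sup>2 * wt b \<alpha>
          = ?c\<^sup>2 * (real (\<alpha> j) + 1) * ((real (\<alpha> j) + 1) * wt b \<alpha>)"
        unfolding norm_of_real power2_abs by (simp add: power2_eq_square mult_ac)
      \<comment> \<open>By \<open>wt_shft\<close> the squared normalised weight is c_k^2 (\<alpha>_j
        + 1) \<alpha>_l, symmetric enough to be bounded by (|c_k| (k + 1))^2.\<close>
      also have "\<dots> = (?c\<^sup>2 * ((real (\<alpha> j) + 1) * real (\<alpha> l))) * wt b (shft j l \<alpha>)"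
        unfolding wt_shft[of \<alpha> l j, OF \<alpha> False] by (simp only: mult_ac)
      also have "\<dots> \<le> (u (mdeg \<alpha>))\<^sup>2 * wt b (shft j l \<alpha>)"
      proof (rule mult_right_mono[OF _ wt_nonneg])
        have "?c\<^sup>2 * ((real (\<alpha> j) + 1) * real (\<alpha> l)) \<le> ?c\<^sup>2 * ((real (mdeg \<alpha>) + 1) * (real (mdeg \<alpha>) + 1))"
          using le_mdeg[of \<alpha> j] le_mdeg[of \<alpha> l] by (intro mult_left_mono mult_mono) auto
        also have "\<dots> = (\<bar>?c\<bar> * (real (mdeg \<alpha>) + 1))\<^sup>2" by (simp add: power_mult_distrib power2_eq_square)
        also have "\<dots> \<le> (u (mdeg \<alpha>))\<^sup>2"
          unfolding u_def using dd_nonneg[of "mdeg \<alpha>", where 'n = 'n] by (intro power_mono) auto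
        finally show "?c\<^sup>2 * ((real (\<alpha> j) + 1) * real (\<alpha> l)) \<le> (u (mdeg \<alpha>))\<^sup>2" .
      qed
      finally show "(cmod (of_real (?c * (real (\<alpha> j) + 1))))\<^sup>2 * wt b \<alpha> \<le> (u (mdeg \<alpha>))\<^sup>2 * wt b (shft j l \<alpha>)" .
    next
      show "inj_on (shft j l) {\<alpha>. \<alpha> l \<noteq> 0}" by (rule inj_on_shft[OF False])
    qed (use False u_nonneg in \<open>auto simp: comm_offdiag\<close>)
    show ?thesis by (rule schatten_weighted_shift[of u, OF refl p]) (use sm in \<open>simp add: u_def\<close>)
  qed
qed

lemma schatten_comm_if_summable:
  fixes j l :: "'n::finite"
  assumes m2: "CARD('n) \<ge> 2" and p: "p \<ge> 1"
    and sm1: "summable (\<lambda>k. delta b (Suc k) powr (2 * p) * real (Suc k) powr (real CARD('n) - p - 1))"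
    and sm2: "summable (\<lambda>k. \<bar>(delta b (Suc k))\<^sup>2 - (delta b k)\<^sup>2\<bar> powr p * real (Suc k) powr (real CARD('n) - 1))"
  shows "schatten b p (comm (Hb_adj b (Mz j)) (Mz l))"
proof (rule schatten_comm[OF p])
  define m where "m = CARD('n)"
  define u where "u k = \<bar>cc TYPE('n) k\<bar> * (real k + 1) + dd TYPE('n) k" for k
  define N where "N k = real (card {\<alpha> :: 'n \<Rightarrow> nat. mdeg \<alpha> = k})" for k
  define S1 where "S1 k = delta b (Suc k) powr (2 * p) * real (Suc k) powr (real m - p - 1)" for k
  define S2 where "S2 k = \<bar>(delta b (Suc k))\<^sup>2 - (delta b k)\<^sup>2\<bar> powr p * real (Suc k) powr (real m - 1)" for k
  have S: "summable S1" "summable S2" using sm1 sm2 by (simp_all add: S1_def[abs_def] S2_def[abs_def] m_def)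
  \<comment> \<open>Degree 0 is dropped, as the series of condition (3) start at 1;
    \<open>K = Suc k\<close> is the actual degree.\<close>
  have "summable (\<lambda>k. N (Suc k) * u (Suc k) powr p)"
  proof (rule summable_comparison_test')
    let ?C = "2 ^ (m - 1) * 2 powr p"
    show "summable (\<lambda>k. ?C * (S2 k + 2 powr p * S1 k))"
      using S by (intro summable_mult summable_add)
    fix k
    define K where "K = Suc k"
    define x where "x = \<bar>(delta b K)\<^sup>2 - (delta b k)\<^sup>2\<bar>"
    define y where "y = (delta b K)\<^sup>2 / real K"
    have K: "real K \<ge> 1" by (simp add: K_def)
    have dd_le: "dd TYPE('n) K \<le> y"
      unfolding dd_def y_def using K by (intro divide_left_mono) auto
    have xy: "x \<ge> 0" "y \<ge> 0" by (simp_all add: x_def y_def)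
    have "cc TYPE('n) K * (real K + real m - 1) = (delta b K)\<^sup>2 - (delta b k)\<^sup>2 - dd TYPE('n) K"
      using cc_dd[OF m2, of K] by (simp add: m_def K_def)
    hence "\<bar>cc TYPE('n) K * (real K + real m - 1)\<bar> \<le> x + dd TYPE('n) K"
      unfolding x_def using dd_nonneg[of K, where 'n = 'n] by linarith
    moreover have "\<bar>cc TYPE('n) K * (real K + real m - 1)\<bar> = \<bar>cc TYPE('n) K\<bar> * (real K + real m - 1)"
      using K by (simp add: abs_mult)
    \<comment> \<open>Here m >= 2 enters, as K + 1 <= K + m - 1.\<close>
    moreover have "\<bar>cc TYPE('n) K\<bar> * (real K + 1) \<le> \<bar>cc TYPE('n) K\<bar> * (real K + real m - 1)"
      using m2 by (intro mult_left_mono) (auto simp: m_def)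
    ultimately have "u K \<le> x + 2 * y" unfolding u_def using dd_le by linarith
    moreover have "u K \<ge> 0" unfolding u_def by (intro add_nonneg_nonneg dd_nonneg) auto
    ultimately have "u K powr p \<le> (x + 2 * y) powr p" using p by (intro powr_mono2) auto
    also have "\<dots> \<le> 2 powr p * (x powr p + (2 * y) powr p)"
      using xy p by (intro powr_add_le) auto
    also have "(2 * y) powr p = 2 powr p * y powr p" using xy by (simp add: powr_mult)
    finally have u_le: "u K powr p \<le> 2 powr p * (x powr p + 2 powr p * y powr p)" .
    have "N K \<le> real ((K + 1) ^ (m - 1))"
      unfolding N_def m_def by (rule of_nat_mono[OF card_mdeg_le])
    also have "\<dots> \<le> (2 * real K) ^ (m - 1)"
      unfolding of_nat_power using K by (intro power_mono) auto
    also have "\<dots> = 2 ^ (m - 1) * real K powr (real m - 1)"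
      using K m2 by (simp add: power_mult_distrib powr_realpow[symmetric] m_def of_nat_diff)
    finally have N_le: "N K \<le> 2 ^ (m - 1) * real K powr (real m - 1)" .
    have "N K * u K powr p \<le> (2 ^ (m - 1) * real K powr (real m - 1)) * (2 powr p * (x powr p + 2 powr p * y powr p))"
      by (intro mult_mono N_le u_le) auto
    also have "\<dots> = ?C * (x powr p * real K powr (real m - 1) + 2 powr p * (y powr p * real K powr (real m - 1)))"
      by (simp add: algebra_simps)
    also have "y powr p * real K powr (real m - 1) = S1 k"
    proof -
      have "(delta b K)\<^sup>2 = delta b K powr 2" using delta_pos[of K] by simp
      hence "y powr p = delta b K powr (2 * p) * real K powr (- p)"
        unfolding y_def using K by (simp add: powr_divide powr_powr powr_minus field_simps)
      moreover have "real K powr (- p) * real K powr (real m - 1) = real K powr (real m - p - 1)"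
        unfolding powr_add[symmetric] by (simp add: algebra_simps)
      ultimately show ?thesis unfolding S1_def K_def[symmetric] by (simp add: mult.assoc)
    qed
    also have "x powr p * real K powr (real m - 1) = S2 k" by (simp add: S2_def x_def K_def)
    finally show "norm (N (Suc k) * u (Suc k) powr p) \<le> ?C * (S2 k + 2 powr p * S1 k)"
      unfolding K_def by (simp add: N_def)
  qed
  thus "summable (\<lambda>k. real (card {\<alpha> :: 'n \<Rightarrow> nat. mdeg \<alpha> = k}) *
               (\<bar>cc TYPE('n) k\<bar> * (real k + 1) + dd TYPE('n) k) powr p)"
    unfolding u_def N_def by (subst (asm) summable_Suc_iff)
qed

text \<open>A single diagonal commutator forces both series to converge: its eigenvalues control the
  slopes \<open>X\<close>, these together control the intercepts \<open>Y\<close>, and the two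
  series are dominated by combinations of \<open>X\<close> and \<open>Y\<close>.\<close>

lemma summable_if_schatten_comm:
  fixes j :: "'n::finite"
  assumes m2: "CARD('n) \<ge> 2" and p: "p \<ge> 1"
    and T: "schatten b p (comm (Hb_adj b (Mz j)) (Mz j))"
  shows "summable (\<lambda>k. delta b (Suc k) powr (2 * p) * real (Suc k) powr (real CARD('n) - p - 1))" (is ?S1)
    and "summable (\<lambda>k. \<bar>(delta b (Suc k))\<^sup>2 - (delta b k)\<^sup>2\<bar> powr p * real (Suc k) powr (real CARD('n) - 1))" (is ?S2)
proof -
  define m where "m = CARD('n)"
  have m: "m > 0" by (simp add: m_def)
  have p0: "p \<ge> 0" using p by simp
  \<comment> \<open>A second coordinate lets \<alpha>_j vary while the degree stays fixed.\<close>
  obtain l :: 'n where l: "j \<noteq> l"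
  proof -
    have "\<not> (UNIV :: 'n set) \<subseteq> {j}"
      using m2 card_mono[of "{j}" "UNIV :: 'n set"] by auto
    then obtain i where "i \<notin> {j}" by blast
    thus ?thesis using that[of i] by auto
  qed
  define V where "V k = (\<Sum>\<alpha> | mdeg (\<alpha> :: 'n \<Rightarrow> nat) = k. \<bar>cc TYPE('n) k * real (\<alpha> j) + dd TYPE('n) k\<bar> powr p)" for k
  have "summable (\<lambda>k. \<Sum>\<alpha> | mdeg (\<alpha> :: 'n \<Rightarrow> nat) = k. cmod (of_real (cc TYPE('n) (mdeg \<alpha>) * real (\<alpha> j) + dd TYPE('n) (mdeg \<alpha>))) powr p)"
    by (rule schatten_diag_summable[OF comm_diag T p0])
  also have "(\<lambda>k. \<Sum>\<alpha> | mdeg (\<alpha> :: 'n \<Rightarrow> nat) = k. cmod (of_real (cc TYPE('n) (mdeg \<alpha>) * real (\<alpha> j) + dd TYPE('n) (mdeg \<alpha>))) powr p) = V"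
    unfolding V_def norm_of_real by (intro ext sum.cong) auto
  finally have V: "summable V" .
  define X where "X k = real (k + 1) ^ (m - 1) * (\<bar>cc TYPE('n) k\<bar> * real k) powr p" for k
  define Y where "Y k = real (k + 1) ^ (m - 1) * dd TYPE('n) k powr p" for k
  have X: "summable X"
  proof (rule summable_comparison_test')
    let ?C = "2 powr p * 2 powr p * 2 * (2 * real m) ^ (m - 1)"
    show "summable (\<lambda>k. ?C * V k)" using V by (rule summable_mult)
    show "norm (X k) \<le> ?C * V k" for k
      using slope_le_sum_affine[OF l p0, of k "cc TYPE('n) k" "dd TYPE('n) k"] by (simp add: X_def V_def m_def)
  qed
  have Y: "summable Y"
  proof (rule summable_comparison_test')
    let ?C = "real m ^ (m - 1) * 2 powr p"
    show "summable (\<lambda>k. ?C * (V k + X k))" using V X by (intro summable_mult summable_add)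
    show "norm (Y k) \<le> ?C * (V k + X k)" for k
      using intercept_le_sum_affine[OF p0 dd_nonneg, of k k "cc TYPE('n) k" j]
      by (simp add: X_def Y_def V_def m_def)
  qed
  have pow_le: "real (Suc k) powr (real m - 1) \<le> real (Suc k + 1) ^ (m - 1)" for k
  proof -
    have "real (Suc k) powr (real m - 1) = real (Suc k) ^ (m - 1)"
      using m by (simp add: powr_realpow[symmetric] of_nat_diff Suc_leI)
    also have "\<dots> \<le> real (Suc k + 1) ^ (m - 1)" by (intro power_mono) auto
    finally show ?thesis .
  qed
  show ?S1
  proof (rule summable_comparison_test')
    show "summable (\<lambda>k. (real m + 1) powr p * Y (Suc k))"
      using Y by (intro summable_mult) (simp add: summable_Suc_iff)
    fix k
    define K where "K = Suc k"
    have K: "real K \<ge> 1" by (simp add: K_def)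
    \<comment> \<open>The constant comes from K + m <= (m + 1) K for K >= 1.\<close>
    have "(delta b K)\<^sup>2 / real K \<le> (real m + 1) * dd TYPE('n) K"
    proof -
      have "real K + real m \<le> (real m + 1) * real K"
        using K mult_left_mono[of 1 "real K" "real m"] by (simp add: algebra_simps)
      hence "(delta b K)\<^sup>2 * (real K + real m) \<le> (delta b K)\<^sup>2 * ((real m + 1) * real K)"
        by (rule mult_left_mono) simp
      thus ?thesis using K m unfolding dd_def m_def[symmetric] by (simp add: divide_simps mult_ac)
    qed
    hence "((delta b K)\<^sup>2 / real K) powr p \<le> ((real m + 1) * dd TYPE('n) K) powr p"
      using p0 by (intro powr_mono2) auto
    also have "\<dots> = (real m + 1) powr p * dd TYPE('n) K powr p"
      using dd_nonneg by (simp add: powr_mult)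
    finally have f1: "((delta b K)\<^sup>2 / real K) powr p * real K powr (real m - 1)
        \<le> ((real m + 1) powr p * dd TYPE('n) K powr p) * real (K + 1) ^ (m - 1)"
      using pow_le[of k] unfolding K_def by (intro mult_mono) auto
    have f2: "((delta b K)\<^sup>2 / real K) powr p = delta b K powr (2 * p) * real K powr (- p)"
    proof -
      have "(delta b K)\<^sup>2 = delta b K powr 2" using delta_pos[of K] by simp
      thus ?thesis using K by (simp add: powr_divide powr_powr powr_minus field_simps)
    qed
    have f3: "real K powr (- p) * real K powr (real m - 1) = real K powr (real m - p - 1)"
      unfolding powr_add[symmetric] by (simp add: algebra_simps)
    have "delta b K powr (2 * p) * real K powr (real m - p - 1)
        = ((delta b K)\<^sup>2 / real K) powr p * real K powr (real m - 1)"
      unfolding f2 f3[symmetric] by (simp only: mult.assoc)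
    also note f1
    also have "((real m + 1) powr p * dd TYPE('n) K powr p) * real (K + 1) ^ (m - 1) = (real m + 1) powr p * Y K"
      by (simp add: Y_def mult_ac)
    finally have "delta b K powr (2 * p) * real K powr (real m - p - 1) \<le> (real m + 1) powr p * Y K" .
    thus "norm (delta b (Suc k) powr (2 * p) * real (Suc k) powr (real CARD('n) - p - 1)) \<le> (real m + 1) powr p * Y (Suc k)"
      by (simp add: K_def m_def)
  qed
  show ?S2
  proof (rule summable_comparison_test')
    show "summable (\<lambda>k. 2 powr p * (real m powr p * X (Suc k) + Y (Suc k)))"
      using X Y by (intro summable_mult summable_add) (simp_all add: summable_Suc_iff)
    fix k
    define K where "K = Suc k"
    have K: "real K \<ge> 1" by (simp add: K_def)
    define c where "c = \<bar>cc TYPE('n) K\<bar>"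
    define x where "x = \<bar>(delta b K)\<^sup>2 - (delta b k)\<^sup>2\<bar>"
    have "x = \<bar>cc TYPE('n) K * (real K + real m - 1) + dd TYPE('n) K\<bar>"
      using cc_dd[OF m2, of K] by (simp add: m_def K_def x_def)
    also have "\<dots> \<le> \<bar>cc TYPE('n) K * (real K + real m - 1)\<bar> + dd TYPE('n) K"
      using dd_nonneg[of K, where 'n = 'n] by linarith
    also have "\<bar>cc TYPE('n) K * (real K + real m - 1)\<bar> = c * (real K + real m - 1)"
      using K m by (simp add: abs_mult c_def)
    also have "c * (real K + real m - 1) \<le> c * (real m * real K)"
    proof (rule mult_left_mono)
      \<comment> \<open>Expanding (m - 1)(K - 1) >= 0 gives K + m - 1 <= m K.\<close>
      have "0 \<le> (real m - 1) * (real K - 1)" using K m by (intro mult_nonneg_nonneg) auto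
      thus "real K + real m - 1 \<le> real m * real K" by (simp add: algebra_simps)
    qed (simp add: c_def)
    finally have "x \<le> real m * (c * real K) + dd TYPE('n) K" by (simp add: mult_ac)
    hence "x powr p \<le> (real m * (c * real K) + dd TYPE('n) K) powr p"
      using p0 by (intro powr_mono2) (auto simp: x_def)
    also have "\<dots> \<le> 2 powr p * ((real m * (c * real K)) powr p + dd TYPE('n) K powr p)"
      using p0 dd_nonneg by (intro powr_add_le) (auto simp: c_def)
    also have "(real m * (c * real K)) powr p = real m powr p * (c * real K) powr p"
      by (simp add: powr_mult c_def)
    finally have "x powr p * real K powr (real m - 1)
        \<le> (2 powr p * (real m powr p * (c * real K) powr p + dd TYPE('n) K powr p)) * real (K + 1) ^ (m - 1)"
      using pow_le[of k] unfolding K_def by (intro mult_mono) auto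
    also have "\<dots> = 2 powr p * (real m powr p * X K + Y K)"
      by (simp add: X_def Y_def c_def algebra_simps)
    finally show "norm (\<bar>(delta b (Suc k))\<^sup>2 - (delta b k)\<^sup>2\<bar> powr p * real (Suc k) powr (real CARD('n) - 1))
        \<le> 2 powr p * (real m powr p * X (Suc k) + Y (Suc k))"
      by (simp add: K_def m_def x_def)
  qed
qed

end

theorem theorem4p2:
  fixes b :: "nat \<Rightarrow> real" and p :: real
  assumes m2: "CARD('n::finite) \<ge> 2"
    and bpos: "\<forall>k. b k > 0"
    and dbdd: "bounded (range (delta b))"
    and p1: "1 \<le> p"
  shows "((\<forall>j::'n. schatten b p (comm (Hb_adj b (Mz j)) (Mz j)))
          \<longleftrightarrow> (\<forall>j l::'n. schatten b p (comm (Hb_adj b (Mz j)) (Mz l))))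
       \<and> ((\<forall>j l::'n. schatten b p (comm (Hb_adj b (Mz j)) (Mz l)))
          \<longleftrightarrow> (summable (\<lambda>k. delta b (Suc k) powr (2 * p) * real (Suc k) powr (real CARD('n) - p - 1))
               \<and> summable (\<lambda>k. \<bar>(delta b (Suc k))\<^sup>2 - (delta b k)\<^sup>2\<bar> powr p * real (Suc k) powr (real CARD('n) - 1))))"
proof -
  obtain D where "\<forall>x\<in>range (delta b). norm x \<le> D"
    using dbdd unfolding bounded_iff by blast
  hence "delta b k \<le> D" for k
    using abs_le_D1[of "delta b k" D] by simp
  then interpret weighted b D
    using bpos by unfold_locales auto
  let ?S = "summable (\<lambda>k. delta b (Suc k) powr (2 * p) * real (Suc k) powr (real CARD('n) - p - 1))
     \<and> summable (\<lambda>k. \<bar>(delta b (Suc k))\<^sup>2 - (delta b k)\<^sup>2\<bar> powr p * real (Suc k) powr (real CARD('n) - 1))"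
  \<comment> \<open>The implications run in the cycle (1) ==> (3) ==> (2) ==> (1), the last one by
    taking l = j.\<close>
  have 1: "?S" if "\<forall>j::'n. schatten b p (comm (Hb_adj b (Mz j)) (Mz j))"
    using summable_if_schatten_comm[OF m2 p1 spec[OF that]] by (rule conjI)
  have 2: "\<forall>j l::'n. schatten b p (comm (Hb_adj b (Mz j)) (Mz l))" if ?S
    using schatten_comm_if_summable[OF m2 p1 conjunct1[OF that] conjunct2[OF that]] by (intro allI)
  show ?thesis
  proof (rule conjI; rule iffI)
    assume "\<forall>j::'n. schatten b p (comm (Hb_adj b (Mz j)) (Mz j))"
    from 2[OF 1[OF this]] show "\<forall>j l::'n. schatten b p (comm (Hb_adj b (Mz j)) (Mz l))" .
  next
    assume "\<forall>j l::'n. schatten b p (comm (Hb_adj b (Mz j)) (Mz l))"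
    hence diag: "\<forall>j::'n. schatten b p (comm (Hb_adj b (Mz j)) (Mz j))" by simp
    show "\<forall>j::'n. schatten b p (comm (Hb_adj b (Mz j)) (Mz j))" by (rule diag)
    show ?S by (rule 1[OF diag])
  next
    assume ?S
    thus "\<forall>j l::'n. schatten b p (comm (Hb_adj b (Mz j)) (Mz l))" by (rule 2)
  qed
qed

end
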